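(* Let $\Delta\subset\mathbb{R}^n$ be a simple polytope and let $y\in\mathbb{R}$, $y\neq-1$. For any choice of polarizing vector for $\Delta$, one has the identity of functions on $\mathbb{R}^n$ $$\mathbf{1}^w_{\Delta}=\sum_{v}(-1)^{\#v}\,\mathbf{1}^{w_v}_{\mathbf{C}^\sharp_v},$$ where the sum is over all vertices $v$ of $\Delta$, $\#v$ is the number of edge vectors at $v$ flipped by the polarizing vector, and $\mathbf{1}^w_\Delta$ and $\mathbf{1}^{w_v}_{\mathbf{C}^\sharp_v}$ are the weighted characteristic functions of $\Delta$ and of the polarized tangent cones $\mathbf{C}^\sharp_v$.
   Context: A polytope in $\mathbb{R}^n$ is a compact convex set of full dimension $n$ that is a finite intersection of closed half-spaces; it is simple if exactly $n$ edges emanate from each vertex. The polytope is not assumed to be integral. For each vertex $v$ choose edge vectors $\alpha_{1,v},\dots,\alpha_{n,v}$ in the directions of the $n$ edges at $v$, pointing from $v$ to other vertices of $\Delta$ (unique up to positive scalars and permutation). A polarizing vector for $\Delta$ is a vector $\xi\in\mathbb{R}^n$ with $\langle\alpha_{j,v},\xi\rangle\neq0$ for all $v$ and $j$. Given $\xi$, set $\alpha^\sharp_{j,v}=\alpha_{j,v}$ if $\langle\alpha_{j,v},\xi\rangle<0$ (unflipped), and $\alpha^\sharp_{j,v}=-\alpha_{j,v}$ if $\langle\alpha_{j,v},\xi\rangle>0$ (flipped). The polarized tangent cone at $v$ is $\mathbf{C}^\sharp_v=v+\sum_{j=1}^n\mathbb{R}_{\ge0}\alpha^\sharp_{j,v}$.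 For $x\in\Delta$, let $c(x)$ be the codimension (in $\mathbb{R}^n$) of the smallest dimensional face of $\Delta$ containing $x$, and define $$\mathbf{1}^w_\Delta(x)=\begin{cases}\left(\frac{1}{1+y}\right)^{c(x)} & x\in\Delta,\\ 0 & x\notin\Delta.\end{cases}$$ For $x\in\mathbf{C}^\sharp_v$, let $F$ be the smallest dimensional face of $\mathbf{C}^\sharp_v$ containing $x$. Let $r_{1,v}(x)$ be the number of unflipped edges of $\mathbf{C}^\sharp_v$ (rays $v+\mathbb{R}_{\ge0}\alpha^\sharp_{j,v}$ with $\alpha^\sharp_{j,v}=\alpha_{j,v}$) that do not lie in $F$, and $r_{2,v}(x)$ the number of flipped edges of $\mathbf{C}^\sharp_v$ (those with $\alpha^\sharp_{j,v}=-\alpha_{j,v}$) that do not lie in $F$. Thus $r_{1,v}(x)+r_{2,v}(x)$ is the codimension of $F$. Define $$w_v(x)=\left(\frac{1}{1+y}\right)^{r_{1,v}(x)}\left(\frac{y}{1+y}\right)^{r_{2,v}(x)},$$ with the convention that a zeroth power equals $1$ (also when $y=0$), and $$\mathbf{1}^{w_v}_{\mathbf{C}^\sharp_v}(x)=\begin{cases} w_v(x) & x\in\mathbf{C}^\sharp_v,\\ 0 & x\notin\mathbf{C}^\sharp_v.\end{cases}$$ *)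

theory Defs
  imports "HOL-Analysis.Analysis"
begin

definition full_dim_polytope :: "(real ^ 'n) set \<Rightarrow> bool" where
  "full_dim_polytope \<Delta> \<longleftrightarrow>
     compact \<Delta> \<and> convex \<Delta> \<and> polyhedron \<Delta> \<and> aff_dim \<Delta> = int CARD('n)"

lemma full_dim_polytope_iff:
  fixes \<Delta> :: "(real ^ 'n) set"
  shows "full_dim_polytope \<Delta> \<longleftrightarrow> polytope \<Delta> \<and> aff_dim \<Delta> = int CARD('n)"
  unfolding full_dim_polytope_def
  by (meson compact_imp_bounded polytope_eq_bounded_polyhedron polytope_imp_compact
      polytope_imp_convex)

definition edges_at :: "(real ^ 'n) set \<Rightarrow> real ^ 'n \<Rightarrow> (real ^ 'n) set set" where
  "edges_at \<Delta> v = {e. e edge_of \<Delta> \<and> v \<in> e}"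

definition simple_polytope :: "(real ^ 'n) set \<Rightarrow> bool" where
  "simple_polytope \<Delta> \<longleftrightarrow> full_dim_polytope \<Delta> \<and>
     (\<forall>v. v extreme_point_of \<Delta> \<longrightarrow> card (edges_at \<Delta> v) = CARD('n))"

text \<open>The index type of the coordinates also enumerates the edges at a vertex;
  \<open>\<alpha> v j\<close> is the \<open>j\<close>-th edge vector at \<open>v\<close>. Values of \<open>\<alpha>\<close> away from the vertices are
  irrelevant.\<close>

definition edge_vectors :: "(real ^ 'n) set \<Rightarrow> (real ^ 'n \<Rightarrow> 'n \<Rightarrow> real ^ 'n) \<Rightarrow> bool" where
  "edge_vectors \<Delta> \<alpha> \<longleftrightarrow>
     (\<forall>v. v extreme_point_of \<Delta> \<longrightarrow>
       (\<exists>E. bij_betw E (UNIV :: 'n set) (edges_at \<Delta> v) \<and>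
         (\<forall>j. \<exists>w t. w extreme_point_of \<Delta> \<and> w \<in> E j \<and> w \<noteq> v \<and> t > 0 \<and>
                 \<alpha> v j = t *\<^sub>R (w - v))))"

definition polarizing :: "(real ^ 'n) set \<Rightarrow> (real ^ 'n \<Rightarrow> 'n \<Rightarrow> real ^ 'n) \<Rightarrow> real ^ 'n \<Rightarrow> bool" where
  "polarizing \<Delta> \<alpha> \<xi> \<longleftrightarrow> (\<forall>v j. v extreme_point_of \<Delta> \<longrightarrow> \<alpha> v j \<bullet> \<xi> \<noteq> 0)"

definition flipped :: "(real ^ 'n \<Rightarrow> 'n \<Rightarrow> real ^ 'n) \<Rightarrow> real ^ 'n \<Rightarrow> real ^ 'n \<Rightarrow> 'n \<Rightarrow> bool" where
  "flipped \<alpha> \<xi> v j \<longleftrightarrow> \<alpha> v j \<bullet> \<xi> > 0"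

definition sharp :: "(real ^ 'n \<Rightarrow> 'n \<Rightarrow> real ^ 'n) \<Rightarrow> real ^ 'n \<Rightarrow> real ^ 'n \<Rightarrow> 'n \<Rightarrow> real ^ 'n" where
  "sharp \<alpha> \<xi> v j = (if flipped \<alpha> \<xi> v j then - \<alpha> v j else \<alpha> v j)"

definition polarized_cone ::
    "(real ^ 'n \<Rightarrow> 'n \<Rightarrow> real ^ 'n) \<Rightarrow> real ^ 'n \<Rightarrow> real ^ 'n \<Rightarrow> (real ^ 'n) set" where
  "polarized_cone \<alpha> \<xi> v =
     {v + (\<Sum>j\<in>UNIV. t j *\<^sub>R sharp \<alpha> \<xi> v j) | t :: 'n \<Rightarrow> real. \<forall>j. 0 \<le> t j}"

definition cone_edge ::
    "(real ^ 'n \<Rightarrow> 'n \<Rightarrow> real ^ 'n) \<Rightarrow> real ^ 'n \<Rightarrow> real ^ 'n \<Rightarrow> 'n \<Rightarrow> (real ^ 'n) set" where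
  "cone_edge \<alpha> \<xi> v j = {v + t *\<^sub>R sharp \<alpha> \<xi> v j | t. 0 \<le> t}"

definition smallest_face :: "'a::euclidean_space set \<Rightarrow> 'a \<Rightarrow> 'a set" where
  "smallest_face S x = (THE F. is_arg_min aff_dim (\<lambda>G. G face_of S \<and> x \<in> G) F)"

lemma smallest_face_eq_Inter:
  fixes S :: "'a::euclidean_space set"
  assumes "convex S" "x \<in> S"
  shows "is_arg_min aff_dim (\<lambda>G. G face_of S \<and> x \<in> G) (smallest_face S x)"
    and "smallest_face S x = \<Inter>{F. F face_of S \<and> x \<in> F}"
proof -
  let ?P = "\<lambda>G. G face_of S \<and> x \<in> G"
  let ?I = "\<Inter>{F. ?P F}"
  have ne: "{F. ?P F} \<noteq> {}"
    using assms face_of_refl by blast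
  have I: "?P ?I"
    using face_of_Inter[OF ne] by blast
  have less: "aff_dim ?I < aff_dim G" if G: "?P G" "G \<noteq> ?I" for G
  proof (rule face_of_aff_dim_lt)
    show "convex G"
      using G face_of_imp_convex by blast
    show "?I face_of G"
      using I G face_of_face[of G S ?I] by blast
    show "?I \<noteq> G"
      using G by blast
  qed
  have min: "is_arg_min aff_dim ?P ?I"
    unfolding is_arg_min_def using I less by (metis (no_types, lifting) less_asym less_irrefl)
  have uniq: "G = ?I" if "is_arg_min aff_dim ?P G" for G
    using that I less unfolding is_arg_min_def by metis
  show eq: "smallest_face S x = ?I"
    unfolding smallest_face_def using min uniq by (rule the_equality)
  show "is_arg_min aff_dim ?P (smallest_face S x)"
    using min eq by simp
qed

definition polytope_weight :: "real \<Rightarrow> (real ^ 'n) set \<Rightarrow> real ^ 'n \<Rightarrow> real" where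
  "polytope_weight y \<Delta> x =
     (if x \<in> \<Delta>
      then (1 / (1 + y)) ^ nat (int CARD('n) - aff_dim (smallest_face \<Delta> x))
      else 0)"

definition unflipped_off_face ::
    "(real ^ 'n \<Rightarrow> 'n \<Rightarrow> real ^ 'n) \<Rightarrow> real ^ 'n \<Rightarrow> real ^ 'n \<Rightarrow> real ^ 'n \<Rightarrow> nat" where
  "unflipped_off_face \<alpha> \<xi> v x =
     card {j. \<not> flipped \<alpha> \<xi> v j \<and>
              \<not> cone_edge \<alpha> \<xi> v j \<subseteq> smallest_face (polarized_cone \<alpha> \<xi> v) x}"

definition flipped_off_face ::
    "(real ^ 'n \<Rightarrow> 'n \<Rightarrow> real ^ 'n) \<Rightarrow> real ^ 'n \<Rightarrow> real ^ 'n \<Rightarrow> real ^ 'n \<Rightarrow> nat" where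
  "flipped_off_face \<alpha> \<xi> v x =
     card {j. flipped \<alpha> \<xi> v j \<and>
              \<not> cone_edge \<alpha> \<xi> v j \<subseteq> smallest_face (polarized_cone \<alpha> \<xi> v) x}"

definition cone_weight ::
    "real \<Rightarrow> (real ^ 'n \<Rightarrow> 'n \<Rightarrow> real ^ 'n) \<Rightarrow> real ^ 'n \<Rightarrow> real ^ 'n \<Rightarrow> real ^ 'n \<Rightarrow> real" where
  "cone_weight y \<alpha> \<xi> v x =
     (if x \<in> polarized_cone \<alpha> \<xi> v
      then (1 / (1 + y)) ^ unflipped_off_face \<alpha> \<xi> v x * (y / (1 + y)) ^ flipped_off_face \<alpha> \<xi> v x
      else 0)"

end

theory Submission
  imports Defs
begin

text \<open>
  Write \<open>c = 1 / (1 + y)\<close>, and let \<open>h F\<close> be \<open>1\<close>, \<open>c\<close> or \<open>0\<close> according to whether the point \<open>x\<close> lies strictly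
  on the inner side of the facet \<open>F\<close>, on its hyperplane, or beyond it. As \<open>\<Delta>\<close> is simple, the edge vectors at
  a vertex \<open>v\<close> form a basis, and the edges at \<open>v\<close> correspond to the facets through \<open>v\<close>, each edge to
  the facet opposite to it. The coordinate of \<open>x - v\<close> along an edge is a positive multiple of the
  slack of the opposite facet. Since \<open>c - 1 = - y / (1 + y)\<close>, the signed weight of the polarized cone at
  \<open>v\<close> is the product over the facets \<open>F\<close> through \<open>v\<close> of \<open>h F\<close> or \<open>h F - 1\<close>, according to whether the opposite
  edge is unflipped or flipped (\<open>signed_cone_weight_eq_prod\<close>).

  Multiply these products out. A set of facets through \<open>v\<close> has an intersection that is a face of \<open>\<Delta>\<close>, and it
  occurs in the product of \<open>v\<close> exactly if all edges of this face at \<open>v\<close> are flipped, that is, if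
  \<open>v\<close> is the lowest vertex of the face with respect to \<open>\<xi>\<close>. Every nonempty face has exactly one lowest
  vertex (\<open>unique_lowest_vertex\<close>). So the sum over the vertices equals a sum over the nonempty faces, with
  signs depending on the dimension only; in particular it is the same for all polarizing vectors
  (\<open>vertex_sum_eq_face_sum\<close>).

  For a given \<open>x\<close> the sum can therefore be computed with a convenient polarizing vector. If \<open>x\<close> is
  outside \<open>\<Delta>\<close>, take one for which \<open>x\<close> lies higher than \<open>\<Delta>\<close>; all polarized cones point downwards, so
  none of them contains \<open>x\<close> (\<open>vertex_sum_outside\<close>). If \<open>x\<close> is in \<open>\<Delta>\<close>, take a perturbation of a functional
  that is maximal exactly on the smallest face containing \<open>x\<close>; only one vertex contributes, and its
  term is \<open>c\<close> to the number of facets through \<open>x\<close> (\<open>vertex_sum_inside\<close>), which is the codimension of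
  the smallest face (\<open>aff_dim_smallest_face\<close>).

  The geometric input is that a polytope lies in the cone of its edges at each vertex
  (\<open>polytope_subset_edge_cone\<close>), which is proved by cutting off the vertex by a hyperplane.
\<close>

section \<open>Smallest faces and edge cones of polytopes\<close>

lemma smallest_face_face_of:
  fixes S :: "'a::euclidean_space set"
  assumes "convex S" "x \<in> S"
  shows "smallest_face S x face_of S" and "x \<in> smallest_face S x"
  using smallest_face_eq_Inter(1)[OF assms] by (auto simp: is_arg_min_def)

lemma smallest_face_subset:
  fixes S :: "'a::euclidean_space set"
  assumes "convex S" "x \<in> F" "F face_of S"
  shows "smallest_face S x \<subseteq> F"
  using assms smallest_face_eq_Inter(2)[of S x] face_of_imp_subset by blast

text \<open>A point on the relative boundary of a polyhedron lies in a proper face of it, so the face would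
  not be smallest.\<close>

lemma mem_rel_interior_smallest_face:
  fixes P :: "'a::euclidean_space set"
  assumes "polyhedron P" "x \<in> P"
  shows "x \<in> rel_interior (smallest_face P x)"
proof (rule ccontr)
  let ?G = "smallest_face P x"
  assume *: "x \<notin> rel_interior ?G"
  have cP: "convex P" using assms polyhedron_imp_convex by blast
  note G = smallest_face_face_of[OF cP assms(2)]
  have pG: "polyhedron ?G" using G(1) assms(1) face_of_polyhedron_polyhedron by blast
  have "x \<in> rel_frontier ?G"
    using * G(2) closure_subset unfolding rel_frontier_def by blast
  then obtain F where F: "F face_of ?G" "F \<noteq> ?G" "x \<in> F"
    using rel_frontier_of_polyhedron_alt[OF pG] by blast
  have "F face_of P" using F(1) G(1) face_of_trans by blast
  then have "?G \<subseteq> F" using smallest_face_subset[OF cP F(3)] by blast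
  then show False using F face_of_imp_subset by blast
qed

lemma mem_open_segment_opposite:
  fixes q d :: "'a::real_vector"
  assumes "0 < s" "0 < t" "d \<noteq> 0"
  shows "q \<in> open_segment (q - s *\<^sub>R d) (q + t *\<^sub>R d)"
proof -
  define u where "u = s / (s + t)"
  have u: "0 < u" "u < 1" "u * t = (1 - u) * s" using assms by (auto simp: u_def field_simps)
  have "(1 - u) *\<^sub>R (q - s *\<^sub>R d) + u *\<^sub>R (q + t *\<^sub>R d) = q + (u * t - (1 - u) * s) *\<^sub>R d"
    by (simp add: algebra_simps)
  then have "q = (1 - u) *\<^sub>R (q - s *\<^sub>R d) + u *\<^sub>R (q + t *\<^sub>R d)" using u(3) by simp
  moreover have "(q + t *\<^sub>R d) - (q - s *\<^sub>R d) = (s + t) *\<^sub>R d" by (simp add: algebra_simps)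
  then have "(q + t *\<^sub>R d) - (q - s *\<^sub>R d) \<noteq> 0" using assms by (simp del: add_diff_cancel_left)
  then have "q - s *\<^sub>R d \<noteq> q + t *\<^sub>R d" by (metis right_minus_eq)
  ultimately show ?thesis using u(1,2) unfolding in_segment by blast
qed

text \<open>If the smallest face through \<open>q\<close> had dimension at least two, the hyperplane would cut it in a
  set that contains a segment around \<open>q\<close>.\<close>

lemma extreme_point_of_hyperplane_slice:
  fixes P :: "'a::euclidean_space set"
  assumes P: "polyhedron P" and q: "q extreme_point_of (P \<inter> {x. a \<bullet> x = b})"
  shows "aff_dim (smallest_face P q) \<le> 1"
proof (rule ccontr)
  let ?G = "smallest_face P q" and ?H = "{x. a \<bullet> x = b}"
  assume "\<not> aff_dim ?G \<le> 1"
  then have two: "aff_dim ?G \<ge> 2" by simp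
  have qP: "q \<in> P" and qH: "a \<bullet> q = b" using q by (auto simp: extreme_point_of_def)
  have cP: "convex P" using P polyhedron_imp_convex by blast
  note G = smallest_face_face_of[OF cP qP]
  have cG: "convex ?G" using G(1) face_of_imp_convex by blast
  have qA: "q \<in> affine hull ?G" using G(2) by (simp add: hull_inc)
  have "aff_dim (affine hull ?G \<inter> ?H) \<ge> 1"
    using two qA qH by (subst aff_dim_affine_Int_hyperplane) auto
  then have "affine hull ?G \<inter> ?H \<noteq> {q}"
    by (metis aff_dim_sing not_one_le_zero)
  then obtain p where p: "p \<in> affine hull ?G" "a \<bullet> p = b" "p \<noteq> q"
    using qA qH by blast
  have opp: "2 *\<^sub>R q - p \<in> affine hull ?G"
    using mem_affine[OF affine_affine_hull qA p(1), of 2 "-1"] by simp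
  have rel: "\<forall>x\<in>affine hull ?G. \<exists>e>1. (1 - e) *\<^sub>R x + e *\<^sub>R q \<in> ?G"
    using convex_rel_interior_iff2[OF cG] G(2) mem_rel_interior_smallest_face[OF P qP] by blast
  obtain d where d: "d > 1" "(1 - d) *\<^sub>R p + d *\<^sub>R q \<in> ?G" using rel p(1) by blast
  obtain e where e: "e > 1" "(1 - e) *\<^sub>R (2 *\<^sub>R q - p) + e *\<^sub>R q \<in> ?G" using rel opp by blast
  let ?r = "(1 - d) *\<^sub>R p + d *\<^sub>R q" and ?s = "(1 - e) *\<^sub>R (2 *\<^sub>R q - p) + e *\<^sub>R q"
  have "a \<bullet> ?r = b" "a \<bullet> ?s = b"
    using p(2) qH by (simp_all add: algebra_simps inner_simps)
  then have rs: "?r \<in> P \<inter> ?H" "?s \<in> P \<inter> ?H"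
    using d(2) e(2) face_of_imp_subset[OF G(1)] by auto
  have r': "?r = q - (d - 1) *\<^sub>R (p - q)" and s': "?s = q + (e - 1) *\<^sub>R (p - q)"
    by (auto simp: algebra_simps scaleR_2)
  have "q \<in> open_segment ?r ?s"
    unfolding r' s' using d(1) e(1) p(3) by (intro mem_open_segment_opposite) auto
  then show False using q rs unfolding extreme_point_of_def by blast
qed

text \<open>A polytope lies in the cone spanned by its edges at a vertex \<open>v\<close>. Cut off \<open>v\<close> by a hyperplane
  close to it. The extreme points of this slice (the vertex figure) lie on edges of \<open>P\<close>, and these
  edges start at \<open>v\<close> because the hyperplane separates \<open>v\<close> from the other vertices. By Krein--Milman
  the whole slice lies in the cone, and the segment from \<open>v\<close> to any other vertex meets the slice.\<close>

lemma polytope_subset_edge_cone: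
  fixes P K :: "'a::euclidean_space set"
  assumes P: "polytope P" and v: "v extreme_point_of P" and K: "convex_cone K"
    and edges: "\<And>e z. \<lbrakk>e edge_of P; v \<in> e; z \<in> e\<rbrakk> \<Longrightarrow> z - v \<in> K"
    and z: "z \<in> P"
  shows "z - v \<in> K"
proof -
  have poly: "polyhedron P" and cP: "convex P" using P polytope_imp_polyhedron polytope_imp_convex by auto
  let ?V = "{w. w extreme_point_of P}"
  have finV: "finite ?V" using poly finite_polyhedron_extreme_points by blast
  have "{v} exposed_face_of P"
    using exposed_face_of_polyhedron[OF poly] v by (simp add: face_of_singleton)
  then obtain a b where ab: "P \<subseteq> {x. a \<bullet> x \<le> b}" "{v} = P \<inter> {x. a \<bullet> x = b}"
    unfolding exposed_face_of_def by blast
  have av: "a \<bullet> v = b" and vP: "v \<in> P" using ab by auto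
  have less: "a \<bullet> w < b" if "w \<in> P" "w \<noteq> v" for w using ab that by force
  \<comment> \<open>The hyperplane at level c separates v from all the other vertices.\<close>
  obtain c where c: "c < b" "\<And>w. w \<in> ?V \<Longrightarrow> w \<noteq> v \<Longrightarrow> a \<bullet> w < c"
  proof -
    define m where "m = Max (insert (b - 1) ((\<lambda>w. a \<bullet> w) ` (?V - {v})))"
    have "m < b" unfolding m_def using finV less by (auto simp: extreme_point_of_def)
    moreover have "a \<bullet> w \<le> m" if "w \<in> ?V" "w \<noteq> v" for w
      unfolding m_def using finV that by (intro Max_ge) auto
    ultimately show ?thesis by (intro that[of "(m + b) / 2"]) (force simp: field_simps)+
  qed
  let ?Q = "P \<inter> {x. a \<bullet> x = c}"
  have polQ: "polytope ?Q" using P polytope_Int_polyhedron polyhedron_hyperplane by blast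
  have extK: "q - v \<in> K" if q: "q extreme_point_of ?Q" for q
  proof -
    let ?G = "smallest_face P q"
    have qP: "q \<in> P" and aq: "a \<bullet> q = c" using q by (auto simp: extreme_point_of_def)
    note G = smallest_face_face_of[OF cP qP]
    have polG: "polytope ?G" using face_of_polytope_polytope[OF P G(1)] .
    have "aff_dim ?G \<noteq> -1" using G(2) aff_dim_empty[of ?G] by blast
    moreover have "aff_dim ?G \<noteq> 0"
    proof
      assume "aff_dim ?G = 0"
      then have "?G = {q}" using G(2) aff_dim_eq_0 by (metis singletonD)
      then have "q \<in> ?V" using G(1) by (simp add: face_of_singleton)
      then show False using c aq av by fastforce
    qed
    ultimately have "aff_dim ?G = 1"
      using extreme_point_of_hyperplane_slice[OF poly q] aff_dim_geq[of ?G] by linarith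
    then have edge: "?G edge_of P" using G(1) by (simp add: edge_of_def)
    have "v \<in> ?G"
    proof (rule ccontr)
      assume nv: "v \<notin> ?G"
      have "{w. w extreme_point_of ?G} \<subseteq> {x. a \<bullet> x < c}"
        using extreme_point_of_face[OF G(1)] c nv by auto
      then have "convex hull {w. w extreme_point_of ?G} \<subseteq> {x. a \<bullet> x < c}"
        by (simp add: hull_minimal convex_halfspace_lt)
      then show False
        using Krein_Milman_Minkowski[of ?G] polG G(2) aq polytope_imp_compact polytope_imp_convex by auto
    qed
    then show ?thesis using edges[OF edge _ G(2)] by blast
  qed
  have cvx: "convex ((+) v ` K)" using K by (simp add: convex_cone_def convex_translation)
  have shift: "w \<in> (+) v ` K" if "w - v \<in> K" for w
    using image_eqI[of w "(+) v" "w - v" K] that by simp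
  have "{q. q extreme_point_of ?Q} \<subseteq> (+) v ` K"
    using extK shift by auto
  then have "convex hull {q. q extreme_point_of ?Q} \<subseteq> (+) v ` K"
    using cvx by (simp add: hull_minimal)
  then have Q: "?Q \<subseteq> (+) v ` K"
    using Krein_Milman_Minkowski[of ?Q] polQ polytope_imp_compact polytope_imp_convex by auto
  have VK: "w \<in> (+) v ` K" if w: "w \<in> ?V" for w
  proof (cases "w = v")
    case True then show ?thesis using convex_cone_contains_0[OF K] shift by simp
  next
    case False
    have aw: "a \<bullet> w < c" and wP: "w \<in> P" using c w False by (auto simp: extreme_point_of_def)
    let ?s = "(b - c) / (b - a \<bullet> w)"
    have s: "0 < ?s" "?s \<le> 1" using aw c(1) by (auto simp: field_simps)
    have "v + ?s *\<^sub>R (w - v) = (1 - ?s) *\<^sub>R v + ?s *\<^sub>R w" by (simp add: algebra_simps)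
    also have "\<dots> \<in> P" using convexD_alt[OF cP vP wP] s by simp
    finally have "v + ?s *\<^sub>R (w - v) \<in> P" .
    moreover have "a \<bullet> (v + ?s *\<^sub>R (w - v)) = c"
    proof -
      have "a \<bullet> (v + t *\<^sub>R (w - v)) = b - t * (b - a \<bullet> w)" for t
        using av by (simp add: inner_simps algebra_simps)
      moreover have "?s * (b - a \<bullet> w) = b - c" using aw c(1) by simp
      ultimately show ?thesis by simp
    qed
    ultimately have "v + ?s *\<^sub>R (w - v) \<in> (+) v ` K" using Q by blast
    then have "?s *\<^sub>R (w - v) \<in> K" by auto
    then have "(1 / ?s) *\<^sub>R (?s *\<^sub>R (w - v)) \<in> K"
      using convex_cone_scaleR[OF K, of "1 / ?s"] s(1) less_imp_le zero_le_divide_1_iff by blast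
    moreover have "?s \<noteq> 0" using s(1) by linarith
    then have "1 / ?s * ?s = 1" using nonzero_eq_divide_eq[of ?s "1 / ?s" 1] by blast
    ultimately have "w - v \<in> K" by (simp only: scaleR_scaleR scaleR_one)
    then show ?thesis using shift by simp
  qed
  have "convex hull ?V \<subseteq> (+) v ` K" using cvx VK by (intro hull_minimal) auto
  then have "P \<subseteq> (+) v ` K"
    using Krein_Milman_Minkowski[of P] P polytope_imp_compact polytope_imp_convex by auto
  then show ?thesis using z by auto
qed

text \<open>Since \<open>v\<close> is extreme, the edge cannot continue beyond \<open>v\<close> on the side opposite to \<open>w\<close>.\<close>

lemma edge_subset_ray:
  fixes P :: "'a::euclidean_space set"
  assumes e: "e edge_of P" and v: "v extreme_point_of P" "v \<in> e" and w: "w \<in> e" "w \<noteq> v"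
    and z: "z \<in> e"
  shows "\<exists>r\<ge>0. z - v = r *\<^sub>R (w - v)"
proof -
  have "aff_dim e = 1" "e face_of P" using e by (auto simp: edge_of_def)
  then have "collinear e" by (simp add: collinear_aff_dim)
  then have "collinear {v, w, z}" using v w z by (auto intro: collinear_subset)
  then have "collinear {0, w - v, z - v}"
    using collinear_3[of w v z] by (simp add: insert_commute)
  then obtain r where r: "z - v = r *\<^sub>R (w - v)"
    using w(2) by (auto simp: collinear_lemma)
  have "r \<ge> 0"
  proof (rule ccontr)
    assume "\<not> r \<ge> 0"
    then have r0: "r < 0" by simp
    have "z = v - (- r) *\<^sub>R (w - v)" "w = v + 1 *\<^sub>R (w - v)" using r by (simp_all add: algebra_simps)
    then have "v \<in> open_segment z w"
      using mem_open_segment_opposite[of "- r" 1 "w - v" v] r0 w(2) by simp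
    moreover have "z \<in> P" "w \<in> P" using z w \<open>e face_of P\<close> face_of_imp_subset by auto
    ultimately show False using v(1) unfolding extreme_point_of_def by blast
  qed
  then show ?thesis using r by blast
qed

lemma tight_set_face_of:
  fixes P :: "'a::euclidean_space set"
  assumes "convex P" and ge: "\<And>i z. i \<in> I \<Longrightarrow> z \<in> P \<Longrightarrow> b i \<le> a i \<bullet> z"
  shows "{z \<in> P. \<forall>i\<in>I. a i \<bullet> z = b i} face_of P"
  unfolding face_of_def
proof (intro conjI ballI impI)
  show "convex {z \<in> P. \<forall>i\<in>I. a i \<bullet> z = b i}"
  proof -
    have "{z \<in> P. \<forall>i\<in>I. a i \<bullet> z = b i} = P \<inter> (\<Inter>i\<in>I. {z. a i \<bullet> z = b i})" by auto
    then show ?thesis using assms(1) by (auto intro!: convex_Int convex_INT convex_hyperplane)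
  qed
next
  fix p q z
  assume pq: "p \<in> P" "q \<in> P" and z: "z \<in> {z \<in> P. \<forall>i\<in>I. a i \<bullet> z = b i}"
    and seg: "z \<in> open_segment p q"
  obtain u where u: "0 < u" "u < 1" "z = (1 - u) *\<^sub>R p + u *\<^sub>R q"
    using seg by (auto simp: in_segment)
  have tight: "a i \<bullet> p = b i \<and> a i \<bullet> q = b i" if i: "i \<in> I" for i
  proof -
    have "(1 - u) * (a i \<bullet> p - b i) + u * (a i \<bullet> q - b i) = a i \<bullet> z - b i"
      unfolding u(3) by (simp add: inner_simps algebra_simps)
    also have "\<dots> = 0" using z i by simp
    finally have "(1 - u) * (a i \<bullet> p - b i) + u * (a i \<bullet> q - b i) = 0" .
    moreover have "0 \<le> (1 - u) * (a i \<bullet> p - b i)" "0 \<le> u * (a i \<bullet> q - b i)"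
      using u ge[OF i pq(1)] ge[OF i pq(2)] by simp_all
    ultimately have "(1 - u) * (a i \<bullet> p - b i) = 0" "u * (a i \<bullet> q - b i) = 0" by linarith+
    then show ?thesis using u by simp
  qed
  show "p \<in> {z \<in> P. \<forall>i\<in>I. a i \<bullet> z = b i}" "q \<in> {z \<in> P. \<forall>i\<in>I. a i \<bullet> z = b i}"
    using tight pq by auto
qed auto

text \<open>A point \<open>z\<close> on which all inequalities tight at \<open>x\<close> are tight belongs to every face through \<open>x\<close>,
  because the segment from \<open>z\<close> to \<open>x\<close> can be prolonged beyond \<open>x\<close> inside \<open>P\<close>. The lemma serves both
  for the polytope and for the polarized cones.\<close>

lemma smallest_face_halfspaces:
  fixes P :: "'a::euclidean_space set"
  assumes fin: "finite I" and P: "P = {z. \<forall>i\<in>I. b i \<le> a i \<bullet> z}" and x: "x \<in> P"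
  shows "smallest_face P x = {z \<in> P. \<forall>i\<in>I. a i \<bullet> x = b i \<longrightarrow> a i \<bullet> z = b i}" (is "_ = ?T")
proof -
  have cP: "convex P"
  proof -
    have "P = (\<Inter>i\<in>I. {z. b i \<le> a i \<bullet> z})" using P by auto
    then show ?thesis by (auto intro!: convex_INT convex_halfspace_ge)
  qed
  show ?thesis
  proof
  have "?T = {z \<in> P. \<forall>i\<in>{i \<in> I. a i \<bullet> x = b i}. a i \<bullet> z = b i}" by auto
  also have "\<dots> face_of P" using cP P by (intro tight_set_face_of) auto
  finally have "?T face_of P" .
  then show "smallest_face P x \<subseteq> ?T" using x by (intro smallest_face_subset[OF cP]) auto
next
  show "?T \<subseteq> smallest_face P x"
  proof
    fix z assume z: "z \<in> ?T"
    have "\<forall>\<^sub>F e in at_right (0::real). b i \<le> a i \<bullet> (x + e *\<^sub>R (x - z))" if i: "i \<in> I" for i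
    proof (cases "a i \<bullet> x = b i")
      case True
      then have "a i \<bullet> z = b i" using z i by auto
      then show ?thesis using True by (simp add: inner_simps)
    next
      case False
      then have "b i < a i \<bullet> x" using x P i by force
      moreover have "((\<lambda>e. a i \<bullet> (x + e *\<^sub>R (x - z))) \<longlongrightarrow> a i \<bullet> (x + 0 *\<^sub>R (x - z))) (at_right 0)"
        by (intro tendsto_intros)
      ultimately have "\<forall>\<^sub>F e in at_right 0. b i < a i \<bullet> (x + e *\<^sub>R (x - z))"
        by (intro order_tendstoD) auto
      then show ?thesis by (rule eventually_mono) auto
    qed
    then have "\<forall>\<^sub>F e in at_right (0::real). \<forall>i\<in>I. b i \<le> a i \<bullet> (x + e *\<^sub>R (x - z))"
      using fin by (simp add: eventually_ball_finite)
    moreover have "\<forall>\<^sub>F e in at_right (0::real). 0 < e" by (rule eventually_at_right_less)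
    ultimately have "\<forall>\<^sub>F e in at_right (0::real). 0 < e \<and> (\<forall>i\<in>I. b i \<le> a i \<bullet> (x + e *\<^sub>R (x - z)))"
      by eventually_elim auto
    then obtain e where e: "0 < e" "x + e *\<^sub>R (x - z) \<in> P"
      using eventually_happens[of _ "at_right (0::real)"] P by auto
    note G = smallest_face_face_of[OF cP x]
    show "z \<in> smallest_face P x"
    proof (cases "z = x")
      case True then show ?thesis using G(2) by simp
    next
      case False
      have "x \<in> open_segment (x - 1 *\<^sub>R (x - z)) (x + e *\<^sub>R (x - z))"
        using e(1) False by (intro mem_open_segment_opposite) auto
      then have "x \<in> open_segment z (x + e *\<^sub>R (x - z))" by simp
      then show ?thesis using face_ofD[OF G(1) _ _ e(2) G(2)] z by blast
    qed
  qed
  qed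
qed

section \<open>Dual bases and perturbed signs\<close>

text \<open>A left inverse of a square matrix is a right inverse.\<close>

lemma biorthogonal_expansion:
  fixes a b :: "'n::finite \<Rightarrow> real ^ 'n"
  assumes "\<And>i j. b i \<bullet> a j = (if i = j then 1 else 0)"
  shows "(\<Sum>j\<in>UNIV. (b j \<bullet> x) *\<^sub>R a j) = x"
proof -
  define A :: "real ^ 'n ^ 'n" where "A = (\<chi> i j. a j $ i)"
  define B :: "real ^ 'n ^ 'n" where "B = (\<chi> i. b i)"
  have "B ** A = mat 1"
    using assms by (simp add: A_def B_def matrix_matrix_mult_def mat_def inner_vec_def vec_eq_iff)
  then have "A ** B = mat 1" using matrix_left_right_inverse by blast
  then have "A *v (B *v x) = x" by (simp add: matrix_vector_mul_assoc)
  moreover have "A *v (B *v x) = (\<Sum>j\<in>UNIV. (b j \<bullet> x) *\<^sub>R a j)"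
    by (simp add: A_def B_def matrix_vector_mult_def inner_vec_def vec_eq_iff mult.commute)
  ultimately show ?thesis by simp
qed

lemma biorthogonal_exists:
  fixes a :: "'n::finite \<Rightarrow> real ^ 'n"
  assumes "span (range a) = UNIV"
  shows "\<exists>b. \<forall>i j. b i \<bullet> a j = (if i = j then 1 else 0)"
proof -
  define A :: "real ^ 'n ^ 'n" where "A = (\<chi> i j. a j $ i)"
  have col: "column j A = a j" for j by (simp add: A_def column_def vec_eq_iff)
  then have "columns A = range a" by (auto simp: columns_def)
  then obtain B :: "real ^ 'n ^ 'n" where "A ** B = mat 1"
    using assms matrix_right_invertible_span_columns[of A] by (auto simp: span_vec_eq)
  then have "B ** A = mat 1" using matrix_left_right_inverse by blast
  then have "(B ** A) $ i $ j = (if i = j then 1 else 0)" for i j by (simp add: mat_def)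
  then have "B $ i \<bullet> a j = (if i = j then 1 else 0)" for i j
    by (simp add: A_def matrix_matrix_mult_def inner_vec_def)
  then show ?thesis by blast
qed

text \<open>An infinitesimal perturbation of \<open>u\<close> in the direction \<open>w\<close> changes no nonzero sign and uses
  \<open>w\<close> to break the ties.\<close>

lemma sgn_inner_perturb:
  fixes u w :: "'a::real_inner"
  assumes "finite D"
  shows "\<exists>e>0. \<forall>d\<in>D. sgn (d \<bullet> (u + e *\<^sub>R w)) = (if d \<bullet> u = 0 then sgn (d \<bullet> w) else sgn (d \<bullet> u))"
proof -
  let ?Q = "\<lambda>d e. sgn (d \<bullet> (u + e *\<^sub>R w)) = (if d \<bullet> u = 0 then sgn (d \<bullet> w) else sgn (d \<bullet> u))"
  have pos: "\<forall>\<^sub>F e in at_right (0::real). 0 < e" by (rule eventually_at_right_less)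
  have "\<forall>\<^sub>F e in at_right (0::real). ?Q d e" for d
  proof (cases "d \<bullet> u = 0")
    case True
    show ?thesis using pos by eventually_elim (simp add: True inner_simps sgn_mult)
  next
    case False
    have lim: "((\<lambda>e. d \<bullet> (u + e *\<^sub>R w)) \<longlongrightarrow> d \<bullet> (u + 0 *\<^sub>R w)) (at_right 0)"
      by (intro tendsto_intros)
    show ?thesis
    proof (cases "0 < d \<bullet> u")
      case True
      then have "\<forall>\<^sub>F e in at_right 0. 0 < d \<bullet> (u + e *\<^sub>R w)"
        using order_tendstoD(1)[OF lim] by simp
      then show ?thesis by eventually_elim (use True in simp)
    next
      case neg: False
      then have "\<forall>\<^sub>F e in at_right 0. 0 > d \<bullet> (u + e *\<^sub>R w)"
        using order_tendstoD(2)[OF lim] False by simp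
      then show ?thesis by eventually_elim (use neg False in simp)
    qed
  qed
  then have "\<forall>\<^sub>F e in at_right (0::real). \<forall>d\<in>D. ?Q d e"
    using assms by (simp add: eventually_ball_finite)
  then have "\<forall>\<^sub>F e in at_right (0::real). 0 < e \<and> (\<forall>d\<in>D. ?Q d e)"
    using pos by eventually_elim auto
  then show ?thesis using eventually_happens[of _ "at_right (0::real)"] by auto
qed

section \<open>Facets of a simple polytope through its vertices\<close>

text \<open>The value of the weighted characteristic function of a half-line at the coordinate \<open>t\<close>. For
  \<open>c = 1 / (1 + y)\<close> it is the factor of an unflipped edge, and \<open>jump c t - 1\<close> is minus the factor
  of a flipped one, as \<open>c - 1 = - y / (1 + y)\<close>.\<close>

definition jump :: "real \<Rightarrow> real \<Rightarrow> real" where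
  "jump c t = (if 0 < t then 1 else if t = 0 then c else 0)"

text \<open>The same jump as a function of the closed half-space alone. This makes it comparable between
  different vertices of one facet, where the coordinates only agree up to positive multiples.\<close>

definition halfspace_weight :: "real \<Rightarrow> 'a::euclidean_space set \<Rightarrow> 'a \<Rightarrow> real" where
  "halfspace_weight c H x = (if x \<in> interior H then 1 else if x \<in> H then c else 0)"

text \<open>What the proof retains of a simple polytope \<open>P\<close> with vertex set \<open>V\<close>: at each vertex the edge
  vectors \<open>\<alpha>\<close> form a basis, whose dual basis \<open>\<beta>\<close> consists of inner facet normals, and each edge leads
  to another vertex.\<close>

locale vertex_frame =
  fixes V P :: "(real ^ 'n) set" and \<alpha> \<beta> :: "real ^ 'n \<Rightarrow> 'n \<Rightarrow> real ^ 'n"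
  assumes finite_V: "finite V" and V_nonempty: "V \<noteq> {}" and P_hull: "P = convex hull V"
    and dual: "v \<in> V \<Longrightarrow> \<beta> v i \<bullet> \<alpha> v j = (if i = j then 1 else 0)"
    and in_cone: "v \<in> V \<Longrightarrow> z \<in> P \<Longrightarrow> \<beta> v i \<bullet> v \<le> \<beta> v i \<bullet> z"
    and neighbour: "v \<in> V \<Longrightarrow> \<exists>s>0. v + s *\<^sub>R \<alpha> v j \<in> V"
begin

lemma V_subset_P: "v \<in> V \<Longrightarrow> v \<in> P"
  using P_hull hull_inc by metis

lemma normal_nonzero: "v \<in> V \<Longrightarrow> \<beta> v j \<noteq> 0"
  using dual[of v j j] by auto

lemma expand: "v \<in> V \<Longrightarrow> (\<Sum>j\<in>UNIV. (\<beta> v j \<bullet> x) *\<^sub>R \<alpha> v j) = x"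
  by (rule biorthogonal_expansion) (rule dual)

lemma inner_expand: "v \<in> V \<Longrightarrow> g \<bullet> x = (\<Sum>j\<in>UNIV. (\<beta> v j \<bullet> x) * (g \<bullet> \<alpha> v j))"
  by (subst (1) expand[symmetric, of v x]) (simp_all add: inner_sum_right)

lemma expand_dual: "v \<in> V \<Longrightarrow> (\<Sum>j\<in>UNIV. (\<alpha> v j \<bullet> g) *\<^sub>R \<beta> v j) = g"
  using biorthogonal_expansion[of "\<alpha> v" "\<beta> v" g] dual[of v] by (auto simp: inner_commute)

definition facet_halfspace :: "real ^ 'n \<Rightarrow> 'n \<Rightarrow> (real ^ 'n) set" where
  "facet_halfspace v j = {z. \<beta> v j \<bullet> v \<le> \<beta> v j \<bullet> z}"

text \<open>The facet-defining half-spaces. They are collected as sets, so that a facet shared by several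
  vertices is counted once.\<close>

definition walls :: "(real ^ 'n) set set" where
  "walls = (\<Union>v\<in>V. range (facet_halfspace v))"

definition walls_at :: "real ^ 'n \<Rightarrow> (real ^ 'n) set set" where
  "walls_at v = {H \<in> walls. v \<in> frontier H}"

definition flip :: "real ^ 'n \<Rightarrow> real ^ 'n \<Rightarrow> (real ^ 'n) set set" where
  "flip \<xi> v = facet_halfspace v ` {j. 0 < \<alpha> v j \<bullet> \<xi>}"

definition generic :: "real ^ 'n \<Rightarrow> bool" where
  "generic \<xi> \<longleftrightarrow> (\<forall>v\<in>V. \<forall>j. \<alpha> v j \<bullet> \<xi> \<noteq> 0)"

definition vertex_term :: "real ^ 'n \<Rightarrow> real \<Rightarrow> real ^ 'n \<Rightarrow> real ^ 'n \<Rightarrow> real" where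
  "vertex_term \<xi> c x v =
     (\<Prod>j\<in>UNIV. jump c (\<beta> v j \<bullet> (x - v)) - of_bool (0 < \<alpha> v j \<bullet> \<xi>))"

definition wall_face :: "(real ^ 'n) set set \<Rightarrow> (real ^ 'n) set" where
  "wall_face X = {z \<in> P. \<forall>H\<in>X. z \<in> frontier H}"

lemma finite_walls: "finite walls"
  unfolding walls_def using finite_V by auto

lemma frontier_facet_halfspace: "v \<in> V \<Longrightarrow> z \<in> frontier (facet_halfspace v j) \<longleftrightarrow> \<beta> v j \<bullet> z = \<beta> v j \<bullet> v"
  using normal_nonzero[of v j] by (auto simp: facet_halfspace_def frontier_halfspace_ge)

lemma halfspace_weight_facet_halfspace:
  "v \<in> V \<Longrightarrow> halfspace_weight c (facet_halfspace v j) x = jump c (\<beta> v j \<bullet> (x - v))"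
  using normal_nonzero[of v j]
  by (auto simp: facet_halfspace_def halfspace_weight_def jump_def inner_diff_right)

text \<open>A facet inequality of \<open>w\<close> that is tight at \<open>v\<close> cannot decrease along an edge at \<open>v\<close>.\<close>

lemma active_normal_nonneg:
  assumes "v \<in> V" "w \<in> V" "\<beta> w i \<bullet> v = \<beta> w i \<bullet> w"
  shows "0 \<le> \<beta> w i \<bullet> \<alpha> v j"
proof -
  obtain s where s: "s > 0" "v + s *\<^sub>R \<alpha> v j \<in> V" using neighbour[OF assms(1)] by blast
  have "\<beta> w i \<bullet> w \<le> \<beta> w i \<bullet> (v + s *\<^sub>R \<alpha> v j)" using in_cone assms(2) s(2) V_subset_P by blast
  then have "0 \<le> s * (\<beta> w i \<bullet> \<alpha> v j)" using assms(3) by (simp add: inner_simps)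
  then show ?thesis using s(1) by (simp add: zero_le_mult_iff)
qed

text \<open>If \<open>\<beta> w i\<close> is tight at \<open>v\<close> and at \<open>z\<close>, then its value on \<open>z - v\<close>, which is zero, is a sum
  of nonnegative contributions of the edges at \<open>v\<close>; the edges along which \<open>z\<close> has a positive
  coordinate therefore stay in the facet.\<close>

lemma active_normal_vanishes:
  assumes v: "v \<in> V" and w: "w \<in> V" and act: "\<beta> w i \<bullet> v = \<beta> w i \<bullet> w"
    and z: "z \<in> P" "\<beta> w i \<bullet> z = \<beta> w i \<bullet> w"
    and j: "\<beta> v j \<bullet> z \<noteq> \<beta> v j \<bullet> v"
  shows "\<beta> w i \<bullet> \<alpha> v j = 0"
proof -
  have "(\<Sum>k\<in>UNIV. (\<beta> v k \<bullet> (z - v)) * (\<beta> w i \<bullet> \<alpha> v k)) = 0"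
    using inner_expand[OF v, of "\<beta> w i" "z - v"] act z(2) by (simp add: inner_diff_right)
  moreover have "0 \<le> (\<beta> v k \<bullet> (z - v)) * (\<beta> w i \<bullet> \<alpha> v k)" for k
    using in_cone[OF v z(1), of k] active_normal_nonneg[OF v w act, of k]
    by (simp add: inner_diff_right)
  ultimately have "(\<beta> v j \<bullet> (z - v)) * (\<beta> w i \<bullet> \<alpha> v j) = 0"
    by (subst (asm) sum_nonneg_eq_0_iff) auto
  then show ?thesis using j by (simp add: inner_diff_right)
qed

text \<open>Facet normals at different vertices match up. Let \<open>\<alpha> v j\<close> leave the facet of \<open>\<beta> w i\<close>. Then
  \<open>\<beta> v j\<close> is constant on the facet; but the facet contains \<open>w\<close> and its neighbours along all edges
  other than the \<open>i\<close>-th, so \<open>\<beta> v j\<close> vanishes on \<open>\<alpha> w l\<close> for \<open>l \<noteq> i\<close> and is a multiple of \<open>\<beta> w i\<close>.\<close>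

lemma active_normal_proportional:
  assumes v: "v \<in> V" and w: "w \<in> V" and act: "\<beta> w i \<bullet> v = \<beta> w i \<bullet> w"
  shows "\<exists>j \<kappa>. 0 < \<kappa> \<and> \<beta> w i = \<kappa> *\<^sub>R \<beta> v j"
proof -
  let ?g = "\<lambda>k. \<alpha> v k \<bullet> \<beta> w i"
  have tight: "\<beta> v k \<bullet> z = \<beta> v k \<bullet> v" if "?g k \<noteq> 0" "z \<in> P" "\<beta> w i \<bullet> z = \<beta> w i \<bullet> w" for k z
    using active_normal_vanishes[OF v w act that(2,3), of k] that(1) by (auto simp: inner_commute)
  have multiple: "\<beta> v k = (\<alpha> w i \<bullet> \<beta> v k) *\<^sub>R \<beta> w i" if k: "?g k \<noteq> 0" for k
  proof -
    have "\<alpha> w l \<bullet> \<beta> v k = 0" if l: "l \<noteq> i" for l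
    proof -
      obtain s where s: "s > 0" "w + s *\<^sub>R \<alpha> w l \<in> V" using neighbour[OF w] by blast
      have "\<beta> w i \<bullet> (w + s *\<^sub>R \<alpha> w l) = \<beta> w i \<bullet> w"
        using dual[OF w, of i l] l by (simp add: inner_simps)
      then have "\<beta> v k \<bullet> (w + s *\<^sub>R \<alpha> w l) = \<beta> v k \<bullet> v"
        using tight[OF k] V_subset_P[OF s(2)] by blast
      moreover have "\<beta> v k \<bullet> w = \<beta> v k \<bullet> v" using tight[OF k V_subset_P[OF w]] by simp
      ultimately show ?thesis using s(1) by (simp add: inner_simps inner_commute)
    qed
    then have "(\<Sum>l\<in>UNIV. (\<alpha> w l \<bullet> \<beta> v k) *\<^sub>R \<beta> w l) = (\<Sum>l\<in>{i}. (\<alpha> w l \<bullet> \<beta> v k) *\<^sub>R \<beta> w l)"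
      by (intro sum.mono_neutral_right) auto
    then show ?thesis using expand_dual[OF w, of "\<beta> v k"] by simp
  qed
  obtain j where j: "?g j \<noteq> 0"
  proof (rule ccontr)
    assume "\<not> thesis"
    then have "\<forall>k. ?g k = 0" using that by blast
    then have "\<beta> w i = 0" using expand_dual[OF v, of "\<beta> w i"] by simp
    then show False using normal_nonzero[OF w] by blast
  qed
  have pos: "0 < ?g j" using active_normal_nonneg[OF v w act, of j] j by (simp add: inner_commute)
  let ?c = "\<alpha> w i \<bullet> \<beta> v j"
  have c: "?c * ?g j = 1"
    using arg_cong[OF multiple[OF j], of "\<lambda>x. \<alpha> v j \<bullet> x"] dual[OF v, of j j]
    by (simp add: inner_commute)
  have "?g j *\<^sub>R \<beta> v j = (?c * ?g j) *\<^sub>R \<beta> w i" by (subst multiple[OF j]) (simp add: mult.commute)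
  then have "\<beta> w i = ?g j *\<^sub>R \<beta> v j" using c by simp
  then show ?thesis using pos by blast
qed

text \<open>Simplicity in the form used below: the edges at \<open>v\<close> correspond to the facets through \<open>v\<close>,
  each edge to the unique facet that does not contain it.\<close>

lemma bij_betw_walls_at:
  assumes v: "v \<in> V"
  shows "bij_betw (facet_halfspace v) UNIV (walls_at v)"
  unfolding bij_betw_def
proof
  show "inj (facet_halfspace v)"
  proof (rule injI, rule ccontr)
    fix j k assume eq: "facet_halfspace v j = facet_halfspace v k" and "j \<noteq> k"
    have "v - \<alpha> v j \<in> facet_halfspace v k" "v - \<alpha> v j \<notin> facet_halfspace v j"
      using dual[OF v, of k j] dual[OF v, of j j] \<open>j \<noteq> k\<close> by (auto simp: facet_halfspace_def inner_diff_right)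
    then show False using eq by simp
  qed
  show "range (facet_halfspace v) = walls_at v"
  proof
    show "range (facet_halfspace v) \<subseteq> walls_at v"
      using v by (auto simp: walls_at_def walls_def frontier_facet_halfspace)
    show "walls_at v \<subseteq> range (facet_halfspace v)"
    proof
      fix H assume "H \<in> walls_at v"
      then obtain w i where w: "w \<in> V" "H = facet_halfspace w i" "v \<in> frontier (facet_halfspace w i)"
        by (auto simp: walls_at_def walls_def)
      then have act: "\<beta> w i \<bullet> v = \<beta> w i \<bullet> w" by (simp add: frontier_facet_halfspace)
      obtain j \<kappa> where jk: "0 < \<kappa>" "\<beta> w i = \<kappa> *\<^sub>R \<beta> v j"
        using active_normal_proportional[OF v w(1) act] by blast
      have "\<beta> v j \<bullet> w = \<beta> v j \<bullet> v" using act jk by simp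
      then have "H = facet_halfspace v j" using jk by (simp add: w(2) facet_halfspace_def)
      then show "H \<in> range (facet_halfspace v)" by blast
    qed
  qed
qed

section \<open>Independence of the polarizing vector\<close>

text \<open>The set is a face of \<open>P\<close>, so each of its extreme points is one of \<open>P\<close>.\<close>

lemma wall_face_has_vertex:
  assumes X: "X \<subseteq> walls" and ne: "wall_face X \<noteq> {}"
  shows "V \<inter> wall_face X \<noteq> {}"
proof -
  let ?I = "{(w, i). w \<in> V \<and> facet_halfspace w i \<in> X}"
  have cP: "compact P" "convex P"
    using P_hull finite_V finite_imp_compact_convex_hull by auto
  have eq: "wall_face X = {z \<in> P. \<forall>p\<in>?I. (case p of (w, i) \<Rightarrow> \<beta> w i) \<bullet> z = (case p of (w, i) \<Rightarrow> \<beta> w i \<bullet> w)}"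
  proof -
    have "(\<forall>H\<in>X. z \<in> frontier H) \<longleftrightarrow> (\<forall>(w, i)\<in>?I. z \<in> frontier (facet_halfspace w i))" for z
      using X by (fastforce simp: walls_def)
    then show ?thesis by (auto simp: wall_face_def frontier_facet_halfspace)
  qed
  have face: "wall_face X face_of P"
    unfolding eq using cP in_cone by (intro tight_set_face_of) auto
  then have "compact (wall_face X)" "convex (wall_face X)"
    using cP face_of_imp_compact face_of_imp_convex by auto
  then obtain v where "v extreme_point_of wall_face X"
    using ne extreme_point_exists_convex by blast
  then have "v extreme_point_of P" "v \<in> wall_face X" using extreme_point_of_face[OF face] by auto
  then show ?thesis using extreme_point_of_convex_hull P_hull by blast
qed

text \<open>The condition on \<open>v\<close> says that \<open>v\<close> lies on the face cut out by \<open>X\<close> and that \<open>\<xi>\<close> increases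
  along all edges of this face at \<open>v\<close>. A vertex of the face where \<open>\<xi>\<close> is least has this property,
  as its neighbours on the face are vertices too. Conversely the property forces \<open>v\<close> to be the strict
  minimum on the face, since the face lies in the cone spanned by its edges at \<open>v\<close>.\<close>

lemma unique_lowest_vertex:
  assumes gen: "generic \<xi>" and X: "X \<subseteq> walls" and ne: "wall_face X \<noteq> {}"
  shows "\<exists>!v. v \<in> V \<and> X \<subseteq> walls_at v \<and> walls_at v - X \<subseteq> flip \<xi> v"
proof -
  let ?G = "wall_face X"
  have at: "X \<subseteq> walls_at v \<longleftrightarrow> v \<in> ?G" if "v \<in> V" for v
    using X V_subset_P[OF that] by (auto simp: walls_at_def wall_face_def)
  have fl: "walls_at v - X \<subseteq> flip \<xi> v \<longleftrightarrow> (\<forall>j. facet_halfspace v j \<in> X \<or> 0 < \<alpha> v j \<bullet> \<xi>)" if v: "v \<in> V" for v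
  proof -
    have inj: "inj (facet_halfspace v)" and im: "walls_at v = range (facet_halfspace v)"
      using bij_betw_walls_at[OF v] by (auto simp: bij_betw_def)
    have "facet_halfspace v j \<in> flip \<xi> v \<longleftrightarrow> 0 < \<alpha> v j \<bullet> \<xi>" for j
      unfolding flip_def using inj by (auto dest: injD)
    then show ?thesis unfolding im by blast
  qed
  have fin: "finite (V \<inter> ?G)" using finite_V by blast
  obtain m where m: "m \<in> V \<inter> ?G" "\<And>v. v \<in> V \<inter> ?G \<Longrightarrow> m \<bullet> \<xi> \<le> v \<bullet> \<xi>"
    using ex_min_if_finite[of "(\<lambda>v. v \<bullet> \<xi>) ` (V \<inter> ?G)"] fin wall_face_has_vertex[OF X ne]
    by (auto simp: not_less)
  have "0 < \<alpha> m j \<bullet> \<xi>" if j: "facet_halfspace m j \<notin> X" for j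
  proof -
    have mV: "m \<in> V" and mG: "m \<in> ?G" using m(1) by auto
    obtain s where s: "s > 0" "m + s *\<^sub>R \<alpha> m j \<in> V" using neighbour[OF mV] by blast
    have "m + s *\<^sub>R \<alpha> m j \<in> frontier H" if H: "H \<in> X" for H
    proof -
      have "H \<in> walls_at m" using H at[OF mV] mG by blast
      then obtain k where k: "H = facet_halfspace m k" using bij_betw_walls_at[OF mV] by (auto simp: bij_betw_def)
      then have "k \<noteq> j" using H j by blast
      then show ?thesis unfolding k frontier_facet_halfspace[OF mV] using dual[OF mV, of k j] by (simp add: inner_simps)
    qed
    then have "m + s *\<^sub>R \<alpha> m j \<in> V \<inter> ?G" using s(2) V_subset_P by (auto simp: wall_face_def)
    then have "0 \<le> s * (\<alpha> m j \<bullet> \<xi>)" using m(2) by (fastforce simp: inner_simps)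
    then have "0 \<le> \<alpha> m j \<bullet> \<xi>" using s(1) by (simp add: zero_le_mult_iff)
    then show ?thesis using gen mV unfolding generic_def by (metis order_less_le)
  qed
  then have ex: "m \<in> V \<and> X \<subseteq> walls_at m \<and> walls_at m - X \<subseteq> flip \<xi> m"
    using m(1) at fl by blast
  have low: "v \<bullet> \<xi> < z \<bullet> \<xi>"
    if v: "v \<in> V" "X \<subseteq> walls_at v" "walls_at v - X \<subseteq> flip \<xi> v" and z: "z \<in> ?G" "z \<noteq> v" for v z
  proof -
    let ?t = "\<lambda>j. \<beta> v j \<bullet> (z - v)"
    have nonneg: "0 \<le> ?t j" for j
      using in_cone[OF v(1), of z j] z(1) by (simp add: wall_face_def inner_diff_right)
    have dir: "0 < \<alpha> v j \<bullet> \<xi>" if "?t j \<noteq> 0" for j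
    proof -
      have "z \<notin> frontier (facet_halfspace v j)" using that by (simp add: frontier_facet_halfspace v(1) inner_diff_right)
      then have "facet_halfspace v j \<notin> X" using z(1) by (auto simp: wall_face_def)
      then show ?thesis using fl v by blast
    qed
    have exp: "(z - v) \<bullet> \<xi> = (\<Sum>j\<in>UNIV. ?t j * (\<alpha> v j \<bullet> \<xi>))"
      using inner_expand[OF v(1), of \<xi> "z - v"] by (simp add: inner_commute)
    obtain j where j: "?t j \<noteq> 0"
    proof (rule ccontr)
      assume "\<not> thesis"
      then have "\<forall>k. ?t k = 0" using that by blast
      then have "z - v = 0" using expand[OF v(1), of "z - v"] by simp
      then show False using z(2) by simp
    qed
    have "0 < (\<Sum>j\<in>UNIV. ?t j * (\<alpha> v j \<bullet> \<xi>))"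
    proof (rule sum_pos2[of _ j])
      show "0 < ?t j * (\<alpha> v j \<bullet> \<xi>)" using nonneg[of j] dir[OF j] j by simp
      show "0 \<le> ?t k * (\<alpha> v k \<bullet> \<xi>)" for k using nonneg[of k] dir[of k] by (cases "?t k = 0") auto
    qed auto
    then show ?thesis using exp by (simp add: inner_diff_left)
  qed
  show ?thesis
  proof (rule ex1I[of _ m])
    show "m \<in> V \<and> X \<subseteq> walls_at m \<and> walls_at m - X \<subseteq> flip \<xi> m" by (rule ex)
    fix v assume v: "v \<in> V \<and> X \<subseteq> walls_at v \<and> walls_at v - X \<subseteq> flip \<xi> v"
    show "v = m"
    proof (rule ccontr)
      assume "v \<noteq> m"
      moreover have "v \<in> ?G" "m \<in> ?G" using at v ex by auto
      ultimately show False using low[of v m] low[of m v] v ex by force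
    qed
  qed
qed

text \<open>The product over the edges at \<open>v\<close>, rewritten as a product over the walls at \<open>v\<close>, is multiplied
  out; \<open>X\<close> is the set of walls whose first summand is chosen.\<close>

lemma vertex_term_expand:
  assumes v: "v \<in> V"
  shows "vertex_term \<xi> c x v =
    (\<Sum>X\<in>Pow walls. of_bool (X \<subseteq> walls_at v \<and> walls_at v - X \<subseteq> flip \<xi> v) *
       ((-1) ^ (CARD('n) - card X) * (\<Prod>H\<in>X. halfspace_weight c H x)))"
proof -
  let ?h = "\<lambda>H. halfspace_weight c H x" and ?A = "walls_at v"
  have sub: "?A \<subseteq> walls" by (auto simp: walls_at_def)
  have finA: "finite ?A" using sub finite_walls finite_subset by blast
  note bij = bij_betw_walls_at[OF v]
  have cardA: "card ?A = CARD('n)" using bij_betw_same_card[OF bij] by simp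
  have inj: "inj (facet_halfspace v)" using bij by (simp add: bij_betw_def)
  have fl: "facet_halfspace v j \<in> flip \<xi> v \<longleftrightarrow> 0 < \<alpha> v j \<bullet> \<xi>" for j
    unfolding flip_def using inj by (auto dest: injD)
  have "vertex_term \<xi> c x v = (\<Prod>j\<in>UNIV. ?h (facet_halfspace v j) + - of_bool (facet_halfspace v j \<in> flip \<xi> v))"
    unfolding vertex_term_def by (simp add: halfspace_weight_facet_halfspace[OF v] fl)
  also have "\<dots> = (\<Prod>H\<in>?A. ?h H + - of_bool (H \<in> flip \<xi> v))"
    by (rule prod.reindex_bij_betw[OF bij])
  also have "\<dots> = (\<Sum>X\<in>Pow ?A. (\<Prod>H\<in>X. ?h H) * (\<Prod>H\<in>?A - X. - of_bool (H \<in> flip \<xi> v)))"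
    by (rule prod_add[OF finA])
  also have "\<dots> = (\<Sum>X\<in>Pow ?A. of_bool (X \<subseteq> ?A \<and> ?A - X \<subseteq> flip \<xi> v) *
       ((-1) ^ (CARD('n) - card X) * (\<Prod>H\<in>X. ?h H)))"
  proof (rule sum.cong[OF refl])
    fix X assume X: "X \<in> Pow ?A"
    have "(\<Prod>H\<in>?A - X. - (of_bool (H \<in> flip \<xi> v)) :: real)
        = (-1) ^ card (?A - X) * (\<Prod>H\<in>?A - X. of_bool (H \<in> flip \<xi> v))"
      by (rule prod_uminus)
    also have "card (?A - X) = CARD('n) - card X"
      using X finA cardA by (simp add: card_Diff_subset finite_subset)
    also have "(\<Prod>H\<in>?A - X. of_bool (H \<in> flip \<xi> v) :: real) = of_bool (?A - X \<subseteq> flip \<xi> v)"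
    proof (cases "?A - X \<subseteq> flip \<xi> v")
      case True
      then show ?thesis by (auto intro!: prod.neutral)
    next
      case False
      then obtain H where "H \<in> ?A - X" "H \<notin> flip \<xi> v" by blast
      then have "(\<Prod>H\<in>?A - X. of_bool (H \<in> flip \<xi> v) :: real) = 0"
        using finA by (intro prod_zero) auto
      then show ?thesis using False by simp
    qed
    finally show "(\<Prod>H\<in>X. ?h H) * (\<Prod>H\<in>?A - X. - of_bool (H \<in> flip \<xi> v))
      = of_bool (X \<subseteq> ?A \<and> ?A - X \<subseteq> flip \<xi> v) * ((-1) ^ (CARD('n) - card X) * (\<Prod>H\<in>X. ?h H))"
      using X by simp
  qed
  also have "\<dots> = (\<Sum>X\<in>Pow walls. of_bool (X \<subseteq> ?A \<and> ?A - X \<subseteq> flip \<xi> v) *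
       ((-1) ^ (CARD('n) - card X) * (\<Prod>H\<in>X. ?h H)))"
    using sub finite_walls by (intro sum.mono_neutral_left) auto
  finally show ?thesis .
qed

text \<open>The key point: the right-hand side does not mention \<open>\<xi>\<close>. Each nonempty face is
  counted by exactly one vertex, namely its lowest one.\<close>

lemma vertex_sum_eq_face_sum:
  assumes gen: "generic \<xi>"
  shows "(\<Sum>v\<in>V. vertex_term \<xi> c x v) =
    (\<Sum>X\<in>Pow walls. of_bool (wall_face X \<noteq> {}) *
       ((-1) ^ (CARD('n) - card X) * (\<Prod>H\<in>X. halfspace_weight c H x)))"
proof -
  let ?p = "\<lambda>X v. X \<subseteq> walls_at v \<and> walls_at v - X \<subseteq> flip \<xi> v"
  have count: "(\<Sum>v\<in>V. of_bool (?p X v)) = (of_bool (wall_face X \<noteq> {}) :: real)" if X: "X \<subseteq> walls" for X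
  proof (cases "wall_face X = {}")
    case True
    have "\<not> X \<subseteq> walls_at v" if "v \<in> V" for v
      using True V_subset_P[OF that] by (auto simp: wall_face_def walls_at_def)
    then show ?thesis using True by simp
  next
    case False
    then obtain m where m: "m \<in> V" "?p X m" "\<And>v. v \<in> V \<Longrightarrow> ?p X v \<Longrightarrow> v = m"
      using unique_lowest_vertex[OF gen X] by blast
    have "(\<Sum>v\<in>V. of_bool (?p X v)) = (\<Sum>v\<in>V. if v = m then 1 else 0 :: real)"
    proof (rule sum.cong[OF refl])
      fix v assume "v \<in> V"
      then have "?p X v \<longleftrightarrow> v = m" using m(2,3) by blast
      then show "of_bool (?p X v) = (if v = m then 1 else 0 :: real)" by (simp only: of_bool_def)
    qed
    then show ?thesis using m(1) finite_V False by simp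
  qed
  let ?g = "\<lambda>X. (-1) ^ (CARD('n) - card X) * (\<Prod>H\<in>X. halfspace_weight c H x)"
  have "(\<Sum>v\<in>V. vertex_term \<xi> c x v) = (\<Sum>v\<in>V. \<Sum>X\<in>Pow walls. of_bool (?p X v) * ?g X)"
    by (rule sum.cong[OF refl vertex_term_expand])
  also have "\<dots> = (\<Sum>X\<in>Pow walls. \<Sum>v\<in>V. of_bool (?p X v) * ?g X)"
    by (rule sum.swap)
  also have "\<dots> = (\<Sum>X\<in>Pow walls. of_bool (wall_face X \<noteq> {}) * ?g X)"
  proof (rule sum.cong[OF refl])
    fix X assume "X \<in> Pow walls"
    then have "(\<Sum>v\<in>V. of_bool (?p X v)) = (of_bool (wall_face X \<noteq> {}) :: real)"
      by (intro count) simp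
    then show "(\<Sum>v\<in>V. of_bool (?p X v) * ?g X) = of_bool (wall_face X \<noteq> {}) * ?g X"
      by (simp only: sum_distrib_right[symmetric])
  qed
  finally show ?thesis .
qed

section \<open>Evaluation of the sum over the vertices\<close>

lemma generic_perturbation:
  assumes gen: "generic \<xi>"
  obtains \<eta> where "generic \<eta>"
    and "\<And>v j. v \<in> V \<Longrightarrow> \<alpha> v j \<bullet> u < 0 \<Longrightarrow> \<alpha> v j \<bullet> \<eta> < 0"
    and "\<And>v j. v \<in> V \<Longrightarrow> \<alpha> v j \<bullet> u = 0 \<Longrightarrow> 0 < \<alpha> v j \<bullet> \<eta> \<longleftrightarrow> 0 < \<alpha> v j \<bullet> \<xi>"
    and "\<And>v. v \<in> V \<Longrightarrow> 0 < (x - v) \<bullet> u \<Longrightarrow> 0 < (x - v) \<bullet> \<eta>"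
proof -
  let ?D = "(\<Union>v\<in>V. range (\<alpha> v)) \<union> (\<lambda>v. x - v) ` V"
  have "finite ?D" using finite_V by auto
  from sgn_inner_perturb[OF this, of u \<xi>] obtain e where e: "e > 0"
    "\<forall>d\<in>?D. sgn (d \<bullet> (u + e *\<^sub>R \<xi>)) = (if d \<bullet> u = 0 then sgn (d \<bullet> \<xi>) else sgn (d \<bullet> u))"
    by (elim exE conjE)
  have A: "sgn (\<alpha> v j \<bullet> (u + e *\<^sub>R \<xi>)) = (if \<alpha> v j \<bullet> u = 0 then sgn (\<alpha> v j \<bullet> \<xi>) else sgn (\<alpha> v j \<bullet> u))"
    if "v \<in> V" for v j
    using that by (intro e(2)[rule_format]) auto
  have B: "sgn ((x - v) \<bullet> (u + e *\<^sub>R \<xi>)) = (if (x - v) \<bullet> u = 0 then sgn ((x - v) \<bullet> \<xi>) else sgn ((x - v) \<bullet> u))"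
    if "v \<in> V" for v
    using that by (intro e(2)[rule_format]) auto
  show ?thesis
  proof (rule that[of "u + e *\<^sub>R \<xi>"])
    show "generic (u + e *\<^sub>R \<xi>)"
      unfolding generic_def
    proof (intro ballI allI)
      fix v j assume v: "v \<in> V"
      then have "\<alpha> v j \<bullet> \<xi> \<noteq> 0" using gen by (simp add: generic_def)
      then show "\<alpha> v j \<bullet> (u + e *\<^sub>R \<xi>) \<noteq> 0" using A[OF v, of j] by (metis sgn_eq_0_iff)
    qed
    show "\<alpha> v j \<bullet> (u + e *\<^sub>R \<xi>) < 0" if "v \<in> V" "\<alpha> v j \<bullet> u < 0" for v j
      using A[OF that(1), of j] that(2) by (metis order_less_irrefl sgn_less)
    show "0 < \<alpha> v j \<bullet> (u + e *\<^sub>R \<xi>) \<longleftrightarrow> 0 < \<alpha> v j \<bullet> \<xi>" if "v \<in> V" "\<alpha> v j \<bullet> u = 0" for v j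
      using A[OF that(1), of j] that(2) by (metis sgn_greater)
    show "0 < (x - v) \<bullet> (u + e *\<^sub>R \<xi>)" if "v \<in> V" "0 < (x - v) \<bullet> u" for v
      using B[OF that(1)] that(2) by (metis order_less_irrefl sgn_greater)
  qed
qed

text \<open>A cone that points downwards from \<open>v\<close> contains no point higher than \<open>v\<close>. In terms of factors:
  some edge coordinate of \<open>x - v\<close> has the sign of \<open>\<alpha> v j \<bullet> \<eta>\<close>, so the factor is \<open>1 - 1\<close> or \<open>0 - 0\<close>.\<close>

lemma vertex_term_eq_0:
  assumes v: "v \<in> V" and pos: "0 < (x - v) \<bullet> \<eta>"
  shows "vertex_term \<eta> c x v = 0"
proof -
  have "0 < (\<Sum>j\<in>UNIV. (\<beta> v j \<bullet> (x - v)) * (\<alpha> v j \<bullet> \<eta>))"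
    using pos inner_expand[OF v, of \<eta> "x - v"] by (simp add: inner_commute)
  then obtain j where "0 < (\<beta> v j \<bullet> (x - v)) * (\<alpha> v j \<bullet> \<eta>)"
    by (metis (no_types, lifting) not_less sum_nonpos)
  then have "jump c (\<beta> v j \<bullet> (x - v)) - of_bool (0 < \<alpha> v j \<bullet> \<eta>) = 0"
    by (auto simp: jump_def zero_less_mult_iff)
  then show ?thesis unfolding vertex_term_def by (intro prod_zero[OF finite] bexI[of _ j]) simp_all
qed

text \<open>Choose the polarizing vector so that \<open>x\<close> lies higher than all of \<open>P\<close>; then every term vanishes.\<close>

lemma vertex_sum_outside:
  assumes gen: "generic \<xi>" and x: "x \<notin> P"
  shows "(\<Sum>v\<in>V. vertex_term \<xi> c x v) = 0"
proof -
  have "closed P" "convex P"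
    using P_hull finite_V finite_imp_compact_convex_hull compact_imp_closed by auto
  then obtain a b where ab: "a \<bullet> x < b" "\<forall>z\<in>P. a \<bullet> z > b"
    using separating_hyperplane_closed_point x by blast
  obtain \<eta> where \<eta>: "generic \<eta>" "\<And>v. v \<in> V \<Longrightarrow> 0 < (x - v) \<bullet> (- a) \<Longrightarrow> 0 < (x - v) \<bullet> \<eta>"
    using generic_perturbation[OF gen, of "- a" x] by metis
  have "0 < (x - v) \<bullet> (- a)" if "v \<in> V" for v
  proof -
    have "b < a \<bullet> v" using ab V_subset_P[OF that] by blast
    then show ?thesis using ab(1) by (simp add: inner_diff_right inner_commute[of _ a])
  qed
  then have "(\<Sum>v\<in>V. vertex_term \<eta> c x v) = 0"
    using \<eta>(2) by (intro sum.neutral) (simp add: vertex_term_eq_0)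
  then show ?thesis using vertex_sum_eq_face_sum gen \<eta>(1) by simp
qed

text \<open>Choose the polarizing vector as a perturbation of a functional \<open>u\<close> that is maximal on \<open>P\<close>
  exactly on the smallest face \<open>F\<close> containing \<open>x\<close>. Vertices off \<open>F\<close> lie lower than \<open>x\<close> and contribute
  zero. At a vertex of \<open>F\<close> the edges leaving \<open>F\<close> descend and give a factor \<open>c\<close> each, while an edge inside \<open>F\<close>
  gives \<open>1\<close> or \<open>0\<close> according to whether it descends or ascends. Hence only the highest vertex \<open>m\<close> of
  \<open>F\<close> survives.\<close>

lemma vertex_sum_inside:
  assumes gen: "generic \<xi>" and x: "x \<in> P"
  shows "\<exists>m\<in>V. (\<forall>w\<in>V. \<forall>i. \<beta> w i \<bullet> x = \<beta> w i \<bullet> w \<longrightarrow> \<beta> w i \<bullet> m = \<beta> w i \<bullet> w) \<and>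
    (\<Sum>v\<in>V. vertex_term \<xi> c x v) = c ^ card {j. \<beta> m j \<bullet> x = \<beta> m j \<bullet> m}"
proof -
  let ?act = "{(w, i). w \<in> V \<and> \<beta> w i \<bullet> x = \<beta> w i \<bullet> w}"
  \<comment> \<open>Minus the sum of the inner normals of all facets through \<open>x\<close>; a facet may be counted several
    times, once for each of its vertices, which does no harm.\<close>
  define u where "u = - (\<Sum>(w, i)\<in>?act. \<beta> w i)"
  have finact: "finite ?act"
    by (rule finite_subset[of _ "V \<times> UNIV"]) (use finite_V in auto)
  have u: "d \<bullet> u = - (\<Sum>(w, i)\<in>?act. \<beta> w i \<bullet> d)" for d
    by (simp add: u_def inner_sum_right case_prod_unfold inner_commute)
  obtain \<eta> where \<eta>: "generic \<eta>"
    "\<And>v j. v \<in> V \<Longrightarrow> \<alpha> v j \<bullet> u < 0 \<Longrightarrow> \<alpha> v j \<bullet> \<eta> < 0"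
    "\<And>v j. v \<in> V \<Longrightarrow> \<alpha> v j \<bullet> u = 0 \<Longrightarrow> 0 < \<alpha> v j \<bullet> \<eta> \<longleftrightarrow> 0 < \<alpha> v j \<bullet> \<xi>"
    "\<And>v. v \<in> V \<Longrightarrow> 0 < (x - v) \<bullet> u \<Longrightarrow> 0 < (x - v) \<bullet> \<eta>"
    using generic_perturbation[OF gen, of u x] by metis
  define X where "X = {H \<in> walls. x \<in> frontier H}"
  have XI: "facet_halfspace v j \<in> X \<longleftrightarrow> \<beta> v j \<bullet> x = \<beta> v j \<bullet> v" if "v \<in> V" for v j
    using that by (auto simp: X_def walls_def frontier_facet_halfspace)
  \<comment> \<open>The highest vertex for \<open>\<xi>\<close> is the lowest one for \<open>- \<xi>\<close>.\<close>
  have "generic (- \<xi>)" using gen by (simp add: generic_def)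
  moreover have "x \<in> wall_face X" using x by (simp add: wall_face_def X_def)
  ultimately have "\<exists>!v. v \<in> V \<and> X \<subseteq> walls_at v \<and> walls_at v - X \<subseteq> flip (- \<xi>) v"
    by (intro unique_lowest_vertex) (auto simp: X_def)
  then obtain m where m: "m \<in> V" "X \<subseteq> walls_at m" "walls_at m - X \<subseteq> flip (- \<xi>) m"
    and uniq: "\<And>v. v \<in> V \<Longrightarrow> X \<subseteq> walls_at v \<Longrightarrow> walls_at v - X \<subseteq> flip (- \<xi>) v \<Longrightarrow> v = m"
    by metis
  have onX: "\<beta> w i \<bullet> v = \<beta> w i \<bullet> w" if "X \<subseteq> walls_at v" "w \<in> V" "\<beta> w i \<bullet> x = \<beta> w i \<bullet> w" for v w i
    using that XI[OF that(2), of i] frontier_facet_halfspace[OF that(2), of v i] by (auto simp: walls_at_def)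
  have term_on_face: "vertex_term \<eta> c x v =
      (\<Prod>j\<in>UNIV. if facet_halfspace v j \<in> X then c else of_bool (\<alpha> v j \<bullet> \<xi> < 0))"
    if v: "v \<in> V" and sub: "X \<subseteq> walls_at v" for v
    unfolding vertex_term_def
  proof (rule prod.cong[OF refl])
    fix j
    have dir: "\<alpha> v j \<bullet> \<xi> \<noteq> 0" using gen v by (simp add: generic_def)
    have nonneg: "0 \<le> \<beta> w i \<bullet> \<alpha> v j" if "(w, i) \<in> ?act" for w i
      using active_normal_nonneg[OF v, of w i j] onX[OF sub, of w i] that by auto
    show "jump c (\<beta> v j \<bullet> (x - v)) - of_bool (0 < \<alpha> v j \<bullet> \<eta>) =
        (if facet_halfspace v j \<in> X then c else of_bool (\<alpha> v j \<bullet> \<xi> < 0))"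
    proof (cases "facet_halfspace v j \<in> X")
      case True
      then have act: "(v, j) \<in> ?act" using XI[OF v] v by simp
      have "0 < (\<Sum>(w, i)\<in>?act. \<beta> w i \<bullet> \<alpha> v j)"
      proof (rule sum_pos2[OF finact act])
        show "0 < (case (v, j) of (w, i) \<Rightarrow> \<beta> w i \<bullet> \<alpha> v j)" using dual[OF v, of j j] by simp
        show "0 \<le> (case p of (w, i) \<Rightarrow> \<beta> w i \<bullet> \<alpha> v j)" if "p \<in> ?act" for p
          using nonneg that by (cases p) auto
      qed
      then have "\<alpha> v j \<bullet> u < 0" using u by simp
      then have "\<alpha> v j \<bullet> \<eta> < 0" using \<eta>(2) v by blast
      then show ?thesis using True act by (simp add: jump_def inner_diff_right)
    next
      case False
      then have ne: "\<beta> v j \<bullet> x \<noteq> \<beta> v j \<bullet> v" using XI[OF v] by simp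
      have "\<beta> w i \<bullet> \<alpha> v j = 0" if "(w, i) \<in> ?act" for w i
        using active_normal_vanishes[OF v _ onX[OF sub] x _ ne] that by auto
      then have "(\<Sum>(w, i)\<in>?act. \<beta> w i \<bullet> \<alpha> v j) = 0" by (intro sum.neutral) auto
      then have "\<alpha> v j \<bullet> u = 0" using u by simp
      then have "0 < \<alpha> v j \<bullet> \<eta> \<longleftrightarrow> 0 < \<alpha> v j \<bullet> \<xi>" using \<eta>(3) v by blast
      moreover have "0 < \<beta> v j \<bullet> (x - v)" using in_cone[OF v x, of j] ne by (simp add: inner_diff_right)
      ultimately show ?thesis using False dir by (auto simp: jump_def)
    qed
  qed
  have flm: "\<alpha> m j \<bullet> \<xi> < 0" if "facet_halfspace m j \<notin> X" for j
  proof -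
    have bij: "inj (facet_halfspace m)" "walls_at m = range (facet_halfspace m)"
      using bij_betw_walls_at[OF m(1)] by (auto simp: bij_betw_def)
    have "facet_halfspace m j \<in> flip (- \<xi>) m" using m(3) bij(2) that by blast
    then show ?thesis using bij(1) unfolding flip_def by (auto dest: injD)
  qed
  have other: "vertex_term \<eta> c x v = 0" if v: "v \<in> V" "v \<noteq> m" for v
  proof (cases "X \<subseteq> walls_at v")
    case True
    then obtain H where H: "H \<in> walls_at v" "H \<notin> X" "H \<notin> flip (- \<xi>) v" using uniq v by blast
    then obtain j where j: "H = facet_halfspace v j" using bij_betw_walls_at[OF v(1)] by (auto simp: bij_betw_def)
    then have "\<not> \<alpha> v j \<bullet> \<xi> < 0" using H(3) by (auto simp: flip_def)
    then show ?thesis using H(2) j unfolding term_on_face[OF v(1) True] by (intro prod_zero) auto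
  next
    case False
    then obtain w i where wi: "w \<in> V" "facet_halfspace w i \<in> X" "facet_halfspace w i \<notin> walls_at v"
      unfolding X_def walls_def by blast
    then have act: "(w, i) \<in> ?act" using XI by auto
    have "facet_halfspace w i \<in> walls" using wi(1) by (auto simp: walls_def)
    then have off: "\<beta> w i \<bullet> v \<noteq> \<beta> w i \<bullet> w" using wi frontier_facet_halfspace[OF wi(1)] by (auto simp: walls_at_def)
    have "0 < (\<Sum>(w, i)\<in>?act. \<beta> w i \<bullet> (v - x))"
    proof (rule sum_pos2[OF finact act])
      show "0 < (case (w, i) of (w, i) \<Rightarrow> \<beta> w i \<bullet> (v - x))"
        using act off in_cone[OF wi(1) V_subset_P[OF v(1)], of i] by (simp add: inner_diff_right)
      show "0 \<le> (case p of (w, i) \<Rightarrow> \<beta> w i \<bullet> (v - x))" if "p \<in> ?act" for p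
        using that in_cone[OF _ V_subset_P[OF v(1)]] by (cases p) (auto simp: inner_diff_right)
    qed
    then have "0 < (x - v) \<bullet> u"
      using u[of "v - x"] by (simp add: inner_diff_left)
    then show ?thesis using vertex_term_eq_0 \<eta>(4) v by blast
  qed
  have "(\<Sum>v\<in>V. vertex_term \<xi> c x v) = (\<Sum>v\<in>V. vertex_term \<eta> c x v)"
    using vertex_sum_eq_face_sum gen \<eta>(1) by simp
  also have "\<dots> = (\<Sum>v\<in>{m}. vertex_term \<eta> c x v)"
    using m(1) finite_V other by (intro sum.mono_neutral_right) auto
  also have "\<dots> = (\<Prod>j\<in>UNIV. if facet_halfspace m j \<in> X then c else 1)"
    using flm by (auto simp: term_on_face[OF m(1,2)] intro!: prod.cong)
  also have "\<dots> = c ^ card {j. facet_halfspace m j \<in> X}"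
    by (simp add: prod.If_cases)
  also have "{j. facet_halfspace m j \<in> X} = {j. \<beta> m j \<bullet> x = \<beta> m j \<bullet> m}" using XI[OF m(1)] by simp
  finally show ?thesis using m(1) onX[OF m(2)] by blast
qed

text \<open>A point outside \<open>P\<close> is separated by a functional; at a vertex where this functional is minimal
  all edges go up, so the point violates one of the inequalities of this vertex.\<close>

lemma P_eq_halfspaces: "P = {z. \<forall>p\<in>V \<times> UNIV. (case p of (w, i) \<Rightarrow> \<beta> w i \<bullet> w) \<le> (case p of (w, i) \<Rightarrow> \<beta> w i) \<bullet> z}"
  (is "_ = ?R")
proof
  show "P \<subseteq> ?R"
  proof (intro subsetI CollectI ballI)
    fix z p assume z: "z \<in> P" and "p \<in> V \<times> (UNIV :: 'n set)"
    then obtain w i where "p = (w, i)" "w \<in> V" by blast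
    then show "(case p of (w, i) \<Rightarrow> \<beta> w i \<bullet> w) \<le> (case p of (w, i) \<Rightarrow> \<beta> w i) \<bullet> z"
      using in_cone[of w z i] z by simp
  qed
  show "?R \<subseteq> P"
  proof (rule subsetI, rule ccontr)
    fix z assume z: "z \<in> ?R" and "z \<notin> P"
    have "closed P" "convex P"
      using P_hull finite_V finite_imp_compact_convex_hull compact_imp_closed by auto
    then obtain a b where ab: "a \<bullet> z < b" "\<forall>p\<in>P. a \<bullet> p > b"
      using separating_hyperplane_closed_point \<open>z \<notin> P\<close> by blast
    obtain m where m: "m \<in> V" "\<And>v. v \<in> V \<Longrightarrow> a \<bullet> m \<le> a \<bullet> v"
      using ex_min_if_finite[of "(\<lambda>v. a \<bullet> v) ` V"] finite_V V_nonempty by (auto simp: not_less)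
    have edge: "0 \<le> a \<bullet> \<alpha> m j" for j
    proof -
      obtain s where s: "s > 0" "m + s *\<^sub>R \<alpha> m j \<in> V" using neighbour[OF m(1)] by blast
      then have "0 \<le> s * (a \<bullet> \<alpha> m j)" using m(2) by (fastforce simp: inner_simps)
      then show ?thesis using s(1) by (simp add: zero_le_mult_iff)
    qed
    have "0 \<le> \<beta> m j \<bullet> (z - m)" for j using z m(1) by (auto simp: inner_diff_right)
    then have "0 \<le> a \<bullet> (z - m)"
      unfolding inner_expand[OF m(1), of a "z - m"] using edge by (intro sum_nonneg) simp
    then show False using ab V_subset_P[OF m(1)] by (force simp: inner_diff_right)
  qed
qed

text \<open>The edges at \<open>m\<close> along which \<open>x\<close> has a nonzero coordinate form a basis of the directions of
  the face.\<close>

lemma aff_dim_smallest_face: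
  assumes x: "x \<in> P" and m: "m \<in> V"
    and on: "\<And>w i. w \<in> V \<Longrightarrow> \<beta> w i \<bullet> x = \<beta> w i \<bullet> w \<Longrightarrow> \<beta> w i \<bullet> m = \<beta> w i \<bullet> w"
  shows "aff_dim (smallest_face P x) = int CARD('n) - int (card {j. \<beta> m j \<bullet> x = \<beta> m j \<bullet> m})"
proof -
  let ?F = "smallest_face P x" and ?J = "{j. \<beta> m j \<bullet> x = \<beta> m j \<bullet> m}"
  have F: "?F = {z \<in> P. \<forall>w\<in>V. \<forall>i. \<beta> w i \<bullet> x = \<beta> w i \<bullet> w \<longrightarrow> \<beta> w i \<bullet> z = \<beta> w i \<bullet> w}"
    using smallest_face_halfspaces[OF _ P_eq_halfspaces x] finite_V by auto
  have mF: "m \<in> ?F" unfolding F using on V_subset_P[OF m] by auto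
  let ?D = "(+) (- m) ` ?F" and ?A = "\<alpha> m ` (- ?J)"
  have inj: "inj (\<alpha> m)"
  proof (rule injI)
    fix i j assume "\<alpha> m i = \<alpha> m j"
    then show "i = j" using dual[OF m, of i i] dual[OF m, of i j] by (auto split: if_splits)
  qed
  have "(\<Sum>j\<in>UNIV. (\<beta> m j \<bullet> z) *\<^sub>R \<alpha> m j) \<in> span (range (\<alpha> m))" for z
    by (intro span_sum span_scale span_base) auto
  then have "z \<in> span (range (\<alpha> m))" for z by (simp only: expand[OF m])
  then have "independent (range (\<alpha> m))"
    by (intro card_le_dim_spanning[of _ UNIV]) (auto simp: card_image inj)
  then have ind: "independent ?A" by (rule independent_mono) auto
  have "?D \<subseteq> span ?A"
  proof
    fix d assume "d \<in> ?D"
    then obtain z where z: "z \<in> ?F" "d = z - m" by auto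
    then have "\<beta> m j \<bullet> d = 0" if "j \<in> ?J" for j using that m unfolding F by (auto simp: inner_diff_right)
    then have "(\<beta> m j \<bullet> d) *\<^sub>R \<alpha> m j \<in> span ?A" for j
      by (cases "j \<in> ?J") (simp_all add: span_zero span_scale span_base)
    then show "d \<in> span ?A" using expand[OF m, of d] span_sum[of UNIV "\<lambda>j. (\<beta> m j \<bullet> d) *\<^sub>R \<alpha> m j" ?A] by simp
  qed
  moreover have "?A \<subseteq> span ?D"
  proof
    fix a assume "a \<in> ?A"
    then obtain j where j: "\<beta> m j \<bullet> x \<noteq> \<beta> m j \<bullet> m" "a = \<alpha> m j" by auto
    obtain s where s: "s > 0" "m + s *\<^sub>R \<alpha> m j \<in> V" using neighbour[OF m] by blast
    have "\<beta> w i \<bullet> (m + s *\<^sub>R \<alpha> m j) = \<beta> w i \<bullet> w" if "w \<in> V" "\<beta> w i \<bullet> x = \<beta> w i \<bullet> w" for w i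
      using active_normal_vanishes[OF m that(1) on[OF that] x that(2) j(1)] on[OF that]
      by (simp add: inner_simps)
    then have "m + s *\<^sub>R \<alpha> m j \<in> ?F" unfolding F using V_subset_P[OF s(2)] by auto
    then have "s *\<^sub>R \<alpha> m j \<in> ?D" by force
    then have "(1 / s) *\<^sub>R (s *\<^sub>R \<alpha> m j) \<in> span ?D" by (intro span_scale span_base)
    then show "a \<in> span ?D" using s(1) j(2) by simp
  qed
  ultimately have "span ?D = span ?A" unfolding span_eq by (rule conjI)
  then have "dim ?D = card ?A" using dim_span[of ?D] dim_span[of ?A] dim_eq_card_independent[OF ind] by simp
  also have "\<dots> = card (- ?J)" by (rule card_image[OF inj_on_subset[OF inj]]) simp
  also have "\<dots> = CARD('n) - card ?J" by (simp add: Compl_eq_Diff_UNIV card_Diff_subset)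
  finally have "dim ?D = CARD('n) - card ?J" .
  moreover have "card ?J \<le> CARD('n)" by (intro card_mono) auto
  moreover have "0 \<in> ?D" using mF by force
  then have "aff_dim ?D = int (dim ?D)" by (intro aff_dim_zero hull_inc)
  moreover have "aff_dim ?D = aff_dim ?F" by (rule aff_dim_translation_eq)
  ultimately show ?thesis by simp
qed

end

section \<open>The signed weight of a polarized cone\<close>

lemma prod_if_one:
  fixes k :: "'a::comm_monoid_mult"
  shows "(\<Prod>j\<in>(UNIV :: 'n::finite set). if Q j then k else 1) = k ^ card {j. Q j}"
  by (simp add: prod.If_cases)

lemma polarized_cone_eq_halfspaces:
  fixes \<alpha> :: "real ^ 'n \<Rightarrow> 'n \<Rightarrow> real ^ 'n"
  assumes bio: "\<And>i j. u i \<bullet> sharp \<alpha> \<xi> v j = (if i = j then 1 else 0)"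
  shows "polarized_cone \<alpha> \<xi> v = {x. \<forall>j\<in>UNIV. u j \<bullet> v \<le> u j \<bullet> x}" (is "_ = ?R")
proof
  have coef: "u i \<bullet> (\<Sum>j\<in>UNIV. t j *\<^sub>R sharp \<alpha> \<xi> v j) = t i" for t i
    using bio by (simp add: inner_sum_right if_distrib[of "\<lambda>x. _ * x"] cong: if_cong)
  then show "polarized_cone \<alpha> \<xi> v \<subseteq> ?R"
    by (auto simp: polarized_cone_def inner_add_right)
  show "?R \<subseteq> polarized_cone \<alpha> \<xi> v"
  proof
    fix x assume x: "x \<in> ?R"
    have "x = v + (\<Sum>j\<in>UNIV. (u j \<bullet> (x - v)) *\<^sub>R sharp \<alpha> \<xi> v j)"
      using biorthogonal_expansion[of u "sharp \<alpha> \<xi> v" "x - v"] bio by simp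
    moreover have "\<forall>j. 0 \<le> u j \<bullet> (x - v)" using x by (simp add: inner_diff_right)
    ultimately show "x \<in> polarized_cone \<alpha> \<xi> v"
      unfolding polarized_cone_def by (intro CollectI exI[of _ "\<lambda>j. u j \<bullet> (x - v)"] conjI)
  qed
qed

lemma cone_edge_subset_smallest_face_iff:
  fixes \<alpha> :: "real ^ 'n \<Rightarrow> 'n \<Rightarrow> real ^ 'n"
  assumes bio: "\<And>i j. u i \<bullet> sharp \<alpha> \<xi> v j = (if i = j then 1 else 0)"
    and x: "x \<in> polarized_cone \<alpha> \<xi> v"
  shows "cone_edge \<alpha> \<xi> v j \<subseteq> smallest_face (polarized_cone \<alpha> \<xi> v) x \<longleftrightarrow> u j \<bullet> x \<noteq> u j \<bullet> v"
proof -
  let ?C = "polarized_cone \<alpha> \<xi> v"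
  note C = polarized_cone_eq_halfspaces[of u, OF bio]
  have F: "smallest_face ?C x = {z \<in> ?C. \<forall>i\<in>UNIV. u i \<bullet> x = u i \<bullet> v \<longrightarrow> u i \<bullet> z = u i \<bullet> v}"
    by (rule smallest_face_halfspaces[OF _ C x]) simp
  show ?thesis
  proof
    assume "cone_edge \<alpha> \<xi> v j \<subseteq> smallest_face ?C x"
    moreover have "v + 1 *\<^sub>R sharp \<alpha> \<xi> v j \<in> cone_edge \<alpha> \<xi> v j"
      unfolding cone_edge_def by (intro CollectI exI[of _ 1]) simp
    ultimately have "u j \<bullet> x = u j \<bullet> v \<longrightarrow> u j \<bullet> (v + sharp \<alpha> \<xi> v j) = u j \<bullet> v"
      unfolding F by auto
    then show "u j \<bullet> x \<noteq> u j \<bullet> v" using bio[of j j] by (simp add: inner_add_right)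
  next
    assume ne: "u j \<bullet> x \<noteq> u j \<bullet> v"
    show "cone_edge \<alpha> \<xi> v j \<subseteq> smallest_face ?C x"
    proof
      fix z assume "z \<in> cone_edge \<alpha> \<xi> v j"
      then obtain t where t: "0 \<le> t" "z = v + t *\<^sub>R sharp \<alpha> \<xi> v j" by (auto simp: cone_edge_def)
      have z: "u i \<bullet> z = u i \<bullet> v + (if i = j then t else 0)" for i
        using bio[of i j] by (simp add: t(2) inner_add_right)
      have "z \<in> ?C" by (subst C) (simp add: z t(1))
      then show "z \<in> smallest_face ?C x" unfolding F using ne by (simp add: z)
    qed
  qed
qed

text \<open>The sign and the weight factor over the edges. A flipped edge contributes
  \<open>- y / (1 + y) = 1 / (1 + y) - 1\<close> on the boundary, \<open>-1 = 0 - 1\<close> in the interior, and \<open>0 = 1 - 1\<close>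
  outside.\<close>

lemma signed_cone_weight_eq_prod:
  fixes \<alpha> :: "real ^ 'n \<Rightarrow> 'n \<Rightarrow> real ^ 'n"
  assumes bio: "\<And>i j. b i \<bullet> \<alpha> v j = (if i = j then 1 else 0)" and y: "y \<noteq> -1"
  shows "(-1) ^ card {j. flipped \<alpha> \<xi> v j} * cone_weight y \<alpha> \<xi> v x =
    (\<Prod>j\<in>UNIV. jump (1 / (1 + y)) (b j \<bullet> (x - v)) - of_bool (0 < \<alpha> v j \<bullet> \<xi>))"
proof -
  let ?fl = "flipped \<alpha> \<xi> v" and ?c = "1 / (1 + y)" and ?d = "y / (1 + y)"
  let ?f = "\<lambda>j. jump ?c (b j \<bullet> (x - v)) - of_bool (0 < \<alpha> v j \<bullet> \<xi>)"
  define u where "u j = (if ?fl j then - b j else b j)" for j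
  have bio': "u i \<bullet> sharp \<alpha> \<xi> v j = (if i = j then 1 else 0)" for i j
    using bio by (auto simp: u_def sharp_def)
  note C = polarized_cone_eq_halfspaces[of u, OF bio']
  show ?thesis
  proof (cases "x \<in> polarized_cone \<alpha> \<xi> v")
    case False
    then obtain j where "u j \<bullet> x < u j \<bullet> v" unfolding C by (auto simp: not_le)
    then have "?f j = 0"
      by (auto simp: u_def jump_def flipped_def inner_diff_right split: if_splits)
    then have "(\<Prod>j\<in>UNIV. ?f j) = 0" by (intro prod_zero[OF finite] bexI[of _ j]) simp_all
    then show ?thesis using False by (simp add: cone_weight_def)
  next
    case True
    let ?on = "\<lambda>j. b j \<bullet> x = b j \<bullet> v"
    have off: "\<not> cone_edge \<alpha> \<xi> v j \<subseteq> smallest_face (polarized_cone \<alpha> \<xi> v) x \<longleftrightarrow> ?on j" for j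
      unfolding cone_edge_subset_smallest_face_iff[of u, OF bio' True] by (simp add: u_def)
    have d: "?c - 1 = - ?d" using y by (simp add: field_simps)
    have "?f j = (if ?fl j then -1 else 1) * (if \<not> ?fl j \<and> ?on j then ?c else 1)
        * (if ?fl j \<and> ?on j then ?d else 1)" for j
    proof -
      have "u j \<bullet> v \<le> u j \<bullet> x" using True C by simp
      then show ?thesis
        using d by (cases "?fl j"; cases "?on j")
          (auto simp: u_def jump_def flipped_def inner_diff_right)
    qed
    then have "(\<Prod>j\<in>UNIV. ?f j) = (-1) ^ card {j. ?fl j} * ?c ^ card {j. \<not> ?fl j \<and> ?on j}
        * ?d ^ card {j. ?fl j \<and> ?on j}"
      by (simp only: prod.distrib prod_if_one)
    then show ?thesis
      using True by (simp add: cone_weight_def unflipped_off_face_def flipped_off_face_def off)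
  qed
qed

section \<open>The weighted polar decomposition\<close>

text \<open>The cone of the \<open>n\<close> edge vectors contains the translate of a full-dimensional polytope, so these vectors
  span the space and form a basis; the coordinates of points of \<open>\<Delta>\<close> are nonnegative.\<close>

lemma simple_vertex_dual_basis:
  fixes \<Delta> :: "(real ^ 'n) set"
  assumes simple: "simple_polytope \<Delta>" and ev: "edge_vectors \<Delta> \<alpha>" and v: "v extreme_point_of \<Delta>"
  shows "\<exists>b. (\<forall>i j. b i \<bullet> \<alpha> v j = (if i = j then 1 else 0)) \<and> (\<forall>z\<in>\<Delta>. \<forall>i. b i \<bullet> v \<le> b i \<bullet> z)"
proof -
  have P: "polytope \<Delta>" "aff_dim \<Delta> = int CARD('n)"
    using simple by (auto simp: simple_polytope_def full_dim_polytope_iff)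
  obtain E where E: "bij_betw E (UNIV :: 'n set) (edges_at \<Delta> v)"
    and Ew: "\<forall>j. \<exists>w t. w extreme_point_of \<Delta> \<and> w \<in> E j \<and> w \<noteq> v \<and> t > 0 \<and> \<alpha> v j = t *\<^sub>R (w - v)"
    using ev v unfolding edge_vectors_def by blast
  define K where "K = {(\<Sum>j\<in>UNIV. s j *\<^sub>R \<alpha> v j) | s. \<forall>j. 0 \<le> s j}"
  have KI: "(\<Sum>j\<in>UNIV. s j *\<^sub>R \<alpha> v j) \<in> K" if "\<And>j. 0 \<le> s j" for s
    unfolding K_def using that by blast
  have cone: "convex_cone K"
    unfolding convex_cone_iff
  proof (intro conjI ballI allI impI)
    show "0 \<in> K" using KI[of "\<lambda>_. 0"] by simp
  next
    fix p q assume "p \<in> K" "q \<in> K"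
    then obtain s r where "p = (\<Sum>j\<in>UNIV. s j *\<^sub>R \<alpha> v j)" "q = (\<Sum>j\<in>UNIV. r j *\<^sub>R \<alpha> v j)"
      "\<forall>j. 0 \<le> s j" "\<forall>j. 0 \<le> r j" unfolding K_def by blast
    then show "p + q \<in> K" using KI[of "\<lambda>j. s j + r j"] by (simp add: scaleR_add_left sum.distrib)
  next
    fix p and c :: real assume "p \<in> K" "0 \<le> c"
    then obtain s where "p = (\<Sum>j\<in>UNIV. s j *\<^sub>R \<alpha> v j)" "\<forall>j. 0 \<le> s j" unfolding K_def by blast
    then show "c *\<^sub>R p \<in> K" using KI[of "\<lambda>j. c * s j"] \<open>0 \<le> c\<close> by (simp add: scaleR_sum_right)
  qed
  have edge: "z - v \<in> K" if e: "e edge_of \<Delta>" "v \<in> e" "z \<in> e" for e z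
  proof -
    have "e \<in> edges_at \<Delta> v" using e by (simp add: edges_at_def)
    then obtain j where j: "e = E j" using E by (auto simp: bij_betw_def)
    obtain w t where w: "w \<in> E j" "w \<noteq> v" "t > 0" "\<alpha> v j = t *\<^sub>R (w - v)" using Ew by blast
    obtain r where r: "r \<ge> 0" "z - v = r *\<^sub>R (w - v)"
      using edge_subset_ray[OF e(1) v e(2) _ w(2) e(3)] w(1) j by blast
    have "(\<Sum>k\<in>UNIV. (if k = j then r / t else 0) *\<^sub>R \<alpha> v k) \<in> K"
      using r(1) w(3) by (intro KI) simp
    also have "(\<Sum>k\<in>UNIV. (if k = j then r / t else 0) *\<^sub>R \<alpha> v k) = (r / t) *\<^sub>R \<alpha> v j"
      by (simp add: if_distrib[of "\<lambda>a. a *\<^sub>R _"] cong: if_cong)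
    also have "\<dots> = z - v" using w(3,4) r(2) by simp
    finally show ?thesis .
  qed
  have sub: "z - v \<in> K" if "z \<in> \<Delta>" for z
    using polytope_subset_edge_cone[OF P(1) v cone edge that] .
  have "span (range (\<alpha> v)) = UNIV"
  proof -
    have "K \<subseteq> span (range (\<alpha> v))"
      unfolding K_def by (auto intro!: span_sum span_scale intro: span_base)
    then have "\<Delta> \<subseteq> (+) v ` span (range (\<alpha> v))"
      using sub by (force simp: image_iff algebra_simps)
    then have "affine hull \<Delta> \<subseteq> (+) v ` span (range (\<alpha> v))"
      by (intro hull_minimal) (simp_all add: affine_translation[symmetric] subspace_imp_affine)
    moreover have "affine hull \<Delta> = UNIV" using P(2) aff_dim_eq_full[of \<Delta>] by simp
    ultimately have "(+) v ` span (range (\<alpha> v)) = UNIV" by blast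
    then have "v + z \<in> (+) v ` span (range (\<alpha> v))" for z by blast
    then have "z \<in> span (range (\<alpha> v))" for z by (metis add_left_imp_eq imageE)
    then show ?thesis by blast
  qed
  then obtain b where b: "\<And>i j. b i \<bullet> \<alpha> v j = (if i = j then 1 else 0)"
    using biorthogonal_exists by blast
  have "b i \<bullet> v \<le> b i \<bullet> z" if z: "z \<in> \<Delta>" for z i
  proof -
    obtain s where s: "z - v = (\<Sum>j\<in>UNIV. s j *\<^sub>R \<alpha> v j)" "\<forall>j. 0 \<le> s j"
      using sub[OF z] unfolding K_def by blast
    have "b i \<bullet> (z - v) = s i"
      unfolding s(1) using b by (simp add: inner_sum_right if_distrib[of "\<lambda>x. _ * x"] cong: if_cong)
    then show ?thesis using s(2) by (metis diff_ge_0_iff_ge inner_diff_right)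
  qed
  then show ?thesis using b by blast
qed

lemma simple_polytope_vertex_frame:
  fixes \<Delta> :: "(real ^ 'n) set"
  assumes simple: "simple_polytope \<Delta>" and ev: "edge_vectors \<Delta> \<alpha>"
  obtains \<beta> where "vertex_frame {v. v extreme_point_of \<Delta>} \<Delta> \<alpha> \<beta>"
proof -
  let ?V = "{v. v extreme_point_of \<Delta>}"
  have P: "polytope \<Delta>" "aff_dim \<Delta> = int CARD('n)"
    using simple by (auto simp: simple_polytope_def full_dim_polytope_iff)
  have hull: "\<Delta> = convex hull ?V"
    using P(1) by (intro Krein_Milman_Minkowski polytope_imp_compact polytope_imp_convex)
  have "\<forall>v\<in>?V. \<exists>b. (\<forall>i j. b i \<bullet> \<alpha> v j = (if i = j then 1 else 0)) \<and> (\<forall>z\<in>\<Delta>. \<forall>i. b i \<bullet> v \<le> b i \<bullet> z)"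
    by (intro ballI simple_vertex_dual_basis[OF simple ev]) simp
  from bchoice[OF this] obtain \<beta> where \<beta>: "\<forall>v\<in>?V. (\<forall>i j. \<beta> v i \<bullet> \<alpha> v j = (if i = j then 1 else 0))
      \<and> (\<forall>z\<in>\<Delta>. \<forall>i. \<beta> v i \<bullet> v \<le> \<beta> v i \<bullet> z)" ..
  have "vertex_frame ?V \<Delta> \<alpha> \<beta>"
  proof
    show "finite ?V" using P(1) polytope_imp_polyhedron finite_polyhedron_extreme_points by blast
    show "?V \<noteq> {}"
    proof
      assume "?V = {}"
      then have "\<Delta> = {}" using hull by (metis convex_hull_empty)
      then show False using P(2) by simp
    qed
    show "\<Delta> = convex hull ?V" by (rule hull)
    fix v and i j :: 'n assume v: "v \<in> ?V"
    show "\<beta> v i \<bullet> \<alpha> v j = (if i = j then 1 else 0)" using \<beta> v by blast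
    show "\<beta> v i \<bullet> v \<le> \<beta> v i \<bullet> z" if "z \<in> \<Delta>" for z using \<beta> v that by blast
    obtain w t where w: "w extreme_point_of \<Delta>" "t > 0" "\<alpha> v j = t *\<^sub>R (w - v)"
      using ev v unfolding edge_vectors_def by blast
    then have "v + (1 / t) *\<^sub>R \<alpha> v j = w" by simp
    then show "\<exists>s>0. v + s *\<^sub>R \<alpha> v j \<in> ?V" using w(1,2) by (intro exI[of _ "1 / t"]) simp
  qed
  then show ?thesis using that by blast
qed

theorem proposition2:
  fixes \<Delta> :: "(real ^ 'n) set"
    and \<alpha> :: "real ^ 'n \<Rightarrow> 'n \<Rightarrow> real ^ 'n"
    and \<xi> :: "real ^ 'n"
    and y :: real
  assumes "simple_polytope \<Delta>"
    and "y \<noteq> -1"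
    and "edge_vectors \<Delta> \<alpha>"
    and "polarizing \<Delta> \<alpha> \<xi>"
  shows "polytope_weight y \<Delta> =
    (\<lambda>x. \<Sum>v | v extreme_point_of \<Delta>. (-1) ^ card {j. flipped \<alpha> \<xi> v j} * cone_weight y \<alpha> \<xi> v x)"
proof
  fix x
  let ?V = "{v. v extreme_point_of \<Delta>}" and ?c = "1 / (1 + y)"
  obtain \<beta> where "vertex_frame ?V \<Delta> \<alpha> \<beta>"
    by (rule simple_polytope_vertex_frame[OF assms(1,3)])
  then interpret vertex_frame ?V \<Delta> \<alpha> \<beta> .
  have gen: "generic \<xi>" using assms(4) unfolding generic_def polarizing_def by blast
  have "(\<Sum>v\<in>?V. (-1) ^ card {j. flipped \<alpha> \<xi> v j} * cone_weight y \<alpha> \<xi> v x)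
      = (\<Sum>v\<in>?V. vertex_term \<xi> ?c x v)"
  proof (rule sum.cong[OF refl])
    fix v assume v: "v \<in> ?V"
    show "(-1) ^ card {j. flipped \<alpha> \<xi> v j} * cone_weight y \<alpha> \<xi> v x = vertex_term \<xi> ?c x v"
      unfolding vertex_term_def by (rule signed_cone_weight_eq_prod[where b = "\<beta> v" and \<alpha> = \<alpha> and v = v, OF dual[OF v] assms(2)])
  qed
  also have "\<dots> = polytope_weight y \<Delta> x"
  proof (cases "x \<in> \<Delta>")
    case True
    obtain m where m: "m \<in> ?V" "\<forall>w\<in>?V. \<forall>i. \<beta> w i \<bullet> x = \<beta> w i \<bullet> w \<longrightarrow> \<beta> w i \<bullet> m = \<beta> w i \<bullet> w"
      "(\<Sum>v\<in>?V. vertex_term \<xi> ?c x v) = ?c ^ card {j. \<beta> m j \<bullet> x = \<beta> m j \<bullet> m}"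
      using vertex_sum_inside[OF gen True, of ?c] by blast
    have "aff_dim (smallest_face \<Delta> x) = int CARD('n) - int (card {j. \<beta> m j \<bullet> x = \<beta> m j \<bullet> m})"
      using m(2) by (intro aff_dim_smallest_face[OF True m(1)]) blast
    then show ?thesis
      unfolding m(3) using True by (simp add: polytope_weight_def)
  next
    case False
    then show ?thesis using vertex_sum_outside[OF gen] by (simp add: polytope_weight_def)
  qed
  finally show "polytope_weight y \<Delta> x =
    (\<Sum>v\<in>?V. (-1) ^ card {j. flipped \<alpha> \<xi> v j} * cone_weight y \<alpha> \<xi> v x)" by simp
qed

end
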